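(* Let $(E,\tau)$ be a topological space, $F$ a separable Banach space with weak topology $\sigma_F$, and let $(\mathcal{X},\mathcal{S})$, $(\mathcal{Y},\mathcal{T})$ be topological spaces with $\mathcal{X}\subset L_0(\Omega,E)$ and $\mathcal{Y}\subset L_0(\Omega,F)$, such that: every sequence $\mathcal{S}$-converging to an element $x$ of $\mathcal{X}$ admits a subsequence converging to $x$ almost everywhere; and every sequence $\mathcal{T}$-converging to an element $y$ of $\mathcal{Y}$ converges to $y$ in the Biting sense. Let $x\in\mathcal{X}$, $y\in\mathcal{Y}$, and let $f:\Omega\times E\times F\to\overline{\mathbb{R}}$ be a $\mathbb{T}\otimes\mathcal{B}(E\times F)$-measurable integrand. Let $((x_n,y_n))_n$ be a sequence of $\mathcal{X}\times\mathcal{Y}$ which $\mathcal{S}\times\mathcal{T}$-converges to $(x,y)$ and satisfies: (a) the sequence $(y_n)_n$ is Nagumo tight; (b) there is $n_0$ such that $(f^-(x_n,y_n))_{n\ge n_0}$ is bounded in $L_1(\Omega,\mathbb{R})$. Let $g$ be the $\tau\times\sigma_F$-sequential lower semicontinuous regularization of $f$, $g_\omega=seq\,(\tau\times\sigma_F)\text{-}li_e f_\omega$. Then $$\liminf_n I_f(x_n,y_n)\ \ge\ I_{g^{**}}(x,y)-\delta^+\big((-f(x_n,y_n))_n\big).$$ If in addition (c) the sequence $((x_n,y_n))_n$ satisfies the lower compactness property with respect to $f$, and (d) for almost every $\omega\in\Omega$, $g_\omega^{**}(x(\omega),y(\omega))=f_\omega(x(\omega),y(\omega))$, then $\liminf_n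 I_f(x_n,y_n)\ge I_f(x,y)$.
   Context: $(\Omega,\mathbb{T},\mu)$ is a measure space with $\mu$ a $\sigma$-finite positive measure and $\mathbb{T}$ $\mu$-complete. $L_0(\Omega,E)$ is the space of classes (a.e. equality) of Borel measurable functions $\Omega\to E$. $f_\omega=f(\omega,\cdot,\cdot)$; $f(x,y)$ is the function $\omega\mapsto f(\omega,x(\omega),y(\omega))$; $I_f(x,y)=\int^*_\Omega f(x,y)\,d\mu$ with $\int^*_\Omega v\,d\mu=\inf\{\int_\Omega u\,d\mu: u\in L_1(\Omega,\mathbb{R}),\ u\ge v\text{ a.e.}\}$; $v^-=\max(-v,0)$. $g_\omega(e,e')=\inf\{\liminf_n f_\omega(e_n,e'_n): e_n\to e\text{ for }\tau,\ e'_n\to e'\text{ weakly in }F\}$. For an integrand $h$ on $\Omega\times E\times F$, $h^{**}$ denotes the partial Fenchel–Moreau biconjugate in the last variable: $h^{**}_\omega(e,e')=(h_\omega(e,\cdot))^{**}(e')$ for $e'\in F$, where for $k:F\to\overline{\mathbb{R}}$, $k^*(f^* )=\sup_{e'\in F}(\langle f^*,e'\rangle-k(e'))$ and $k^{**}(e')=\sup_{f^*\in F^*}(\langle f^*,e'\rangle-k^*(f^* ))$. Biting convergence: $(y_n)_n$ converges to $y$ in the Biting sense if there is an increasing covering (up to a negligible set) $(\Omega_k)_k$ of $\Omega$ by measurable sets such that, for all $k$, $y_n|_{\Omega_k}\to y|_{\Omega_k}$ for $\sigma(L_1(\Omega_k,F),L_1(\Omega_k,F)^* )$. A Nagumo integrand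 on $\Omega\times F$ is a $\mathbb{T}\otimes\mathcal{B}(F)$-measurable non negative integrand $h$ such that for all $\omega$ and $f^*\in F^*$ all sublevel sets of $e'\mapsto h_\omega(e')-\langle f^*,e'\rangle$ are weakly compact. $(y_n)_n$ is Nagumo tight if $\sup_n\int_\Omega h(y_n)\,d\mu<\infty$ for some Nagumo integrand $h$. A subset $X$ of $L_1(\Omega,\mathbb{R})$ is uniformly integrable if it is bounded in $L_1$ and equi-integrable, i.e. for every $\epsilon>0$ there are $\eta>0$ and a measurable $K$ of finite measure with $\sup_{u\in X}\|u1_A\|_1<\epsilon$ whenever $\mu(A)\le\eta$, and $\sup_{u\in X}\|u1_{K^c}\|_1<\epsilon$. $((x_n,y_n))_n$ has the lower compactness property with respect to $f$ if, for some $n_0$, $(f^-(x_n,y_n))_{n\ge n_0}$ is uniformly integrable. $\delta^+((u_n)_n)=\sup_{(S_k)_k}\limsup_k\sup_{n\ge k}\int^*_{S_k}u_n\,d\mu$, the supremum being over all decreasing sequences $(S_k)_k$ of measurable sets with negligible intersection. *)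

theory Defs
  imports "HOL-Analysis.Analysis"
begin

text \<open>
  Separable Banach spaces are types of sort \<open>{banach, second_countable_topology}\<close>, as usual in
  HOL-Analysis. Extended-real-valued integrands on \<open>\<Omega> \<times> E \<times> F\<close> are curried functions, and all
  almost everywhere statements refer to a measure \<open>M\<close> with \<open>space M = \<Omega>\<close>.
\<close>

subsection \<open>Classes of measurable functions\<close>

definition ae_eq :: "'w measure \<Rightarrow> (('w \<Rightarrow> 'a::topological_space) \<times> ('w \<Rightarrow> 'a)) set" where
  "ae_eq M = {(u, v). u \<in> borel_measurable M \<and> v \<in> borel_measurable M \<and> (AE w in M. u w = v w)}"

definition L0 :: "'w measure \<Rightarrow> ('w \<Rightarrow> 'a::topological_space) set set" where
  "L0 M = borel_measurable M // ae_eq M"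

definition ae_class :: "'w measure \<Rightarrow> ('w \<Rightarrow> 'a::topological_space) \<Rightarrow> ('w \<Rightarrow> 'a) set" where
  "ae_class M u = ae_eq M `` {u}"

subsection \<open>Weak topologies\<close>

text \<open>\<open>\<sigma>(X, D)\<close>: the coarsest topology on \<open>X\<close> making every functional in \<open>D\<close> continuous
  (\<open>D\<close> is nonempty in all uses, so that the topspace is \<open>X\<close>).\<close>

definition sigma_topology :: "'a set \<Rightarrow> ('a \<Rightarrow> real) set \<Rightarrow> 'a topology" where
  "sigma_topology X D = topology_generated_by {{x \<in> X. \<phi> x \<in> U} | \<phi> U. \<phi> \<in> D \<and> open U}"

definition weak_topology :: "'f::real_normed_vector topology" where
  "weak_topology = sigma_topology UNIV (range (blinfun_apply :: ('f \<Rightarrow>\<^sub>L real) \<Rightarrow> 'f \<Rightarrow> real))"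

text \<open>Continuous linear functionals on \<open>L\<^sub>1(M, F)\<close>, as functionals on integrable representatives;
  the norm bound forces them to agree on functions that are equal almost everywhere.
  Their values at non-integrable functions are irrelevant.\<close>

definition L1_dual ::
  "'w measure \<Rightarrow> (('w \<Rightarrow> 'f::{banach, second_countable_topology}) \<Rightarrow> real) set" where
  "L1_dual M = {\<Phi>.
     (\<forall>u v. integrable M u \<longrightarrow> integrable M v \<longrightarrow> \<Phi> (\<lambda>w. u w + v w) = \<Phi> u + \<Phi> v) \<and>
     (\<forall>c u. integrable M u \<longrightarrow> \<Phi> (\<lambda>w. c *\<^sub>R u w) = c * \<Phi> u) \<and>
     (\<exists>C. \<forall>u. integrable M u \<longrightarrow> \<bar>\<Phi> u\<bar> \<le> C * (\<integral>w. norm (u w) \<partial>M))}"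

definition weak_L1_topology ::
  "'w measure \<Rightarrow> ('w \<Rightarrow> 'f::{banach, second_countable_topology}) topology" where
  "weak_L1_topology M = sigma_topology {u. integrable M u} (L1_dual M)"

definition biting_converges ::
  "'w measure \<Rightarrow> (nat \<Rightarrow> 'w \<Rightarrow> 'f::{banach, second_countable_topology}) \<Rightarrow> ('w \<Rightarrow> 'f) \<Rightarrow> bool" where
  "biting_converges M ys y \<longleftrightarrow>
     (\<exists>\<Omega>. (\<forall>k. \<Omega> k \<in> sets M) \<and> incseq \<Omega> \<and> space M - (\<Union>k. \<Omega> k) \<in> null_sets M \<and>
       (\<forall>k::nat. (\<forall>n. integrable (restrict_space M (\<Omega> k)) (ys n)) \<and>
          limitin (weak_L1_topology (restrict_space M (\<Omega> k))) ys y sequentially))"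

subsection \<open>Integral functionals\<close>

definition outer_integral :: "'w measure \<Rightarrow> ('w \<Rightarrow> ereal) \<Rightarrow> ereal" where
  "outer_integral M v =
     (INF u \<in> {u. integrable M u \<and> (AE w in M. v w \<le> ereal (u w))}. ereal (\<integral>w. u w \<partial>M))"

definition integral_functional ::
  "'w measure \<Rightarrow> ('w \<Rightarrow> 'e \<Rightarrow> 'f \<Rightarrow> ereal) \<Rightarrow> ('w \<Rightarrow> 'e) \<Rightarrow> ('w \<Rightarrow> 'f) \<Rightarrow> ereal" where
  "integral_functional M f x y = outer_integral M (\<lambda>w. f w (x w) (y w))"

definition delta_plus :: "'w measure \<Rightarrow> (nat \<Rightarrow> 'w \<Rightarrow> ereal) \<Rightarrow> ereal" where
  "delta_plus M u =
     (SUP S \<in> {S. (\<forall>k. S k \<in> sets M) \<and> decseq S \<and> (\<Inter>k. S k) \<in> null_sets M}.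
        limsup (\<lambda>k. SUP n\<in>{k..}. outer_integral (restrict_space M (S k)) (u n)))"

subsection \<open>Regularization and biconjugation of integrands\<close>

definition seq_regularization ::
  "('w \<Rightarrow> 'e::topological_space \<Rightarrow> 'f::real_normed_vector \<Rightarrow> ereal) \<Rightarrow> 'w \<Rightarrow> 'e \<Rightarrow> 'f \<Rightarrow> ereal" where
  "seq_regularization f w e e' =
     Inf {liminf (\<lambda>n. f w (a n) (b n)) | a b.
            a \<longlonglongrightarrow> e \<and> limitin weak_topology b e' sequentially}"

definition conjugate :: "('f::real_normed_vector \<Rightarrow> ereal) \<Rightarrow> ('f \<Rightarrow>\<^sub>L real) \<Rightarrow> ereal" where
  "conjugate k \<phi> = (SUP e. ereal (blinfun_apply \<phi> e) - k e)"

definition biconjugate :: "('f::real_normed_vector \<Rightarrow> ereal) \<Rightarrow> 'f \<Rightarrow> ereal" where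
  "biconjugate k e = (SUP \<phi>. ereal (blinfun_apply \<phi> e) - conjugate k \<phi>)"

definition partial_biconjugate ::
  "('w \<Rightarrow> 'e \<Rightarrow> 'f::real_normed_vector \<Rightarrow> ereal) \<Rightarrow> 'w \<Rightarrow> 'e \<Rightarrow> 'f \<Rightarrow> ereal" where
  "partial_biconjugate h w e = biconjugate (h w e)"

subsection \<open>Nagumo tightness\<close>

definition nagumo_integrand ::
  "'w measure \<Rightarrow> ('w \<Rightarrow> 'f::real_normed_vector \<Rightarrow> ereal) \<Rightarrow> bool" where
  "nagumo_integrand M h \<longleftrightarrow>
     (\<lambda>(w, e). h w e) \<in> borel_measurable (M \<Otimes>\<^sub>M borel) \<and>
     (\<forall>w\<in>space M. \<forall>e. 0 \<le> h w e) \<and>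
     (\<forall>w\<in>space M. \<forall>\<phi> :: 'f \<Rightarrow>\<^sub>L real. \<forall>r::real.
        compactin weak_topology {e. h w e - ereal (blinfun_apply \<phi> e) \<le> ereal r})"

definition nagumo_tight ::
  "'w measure \<Rightarrow> (nat \<Rightarrow> 'w \<Rightarrow> 'f::real_normed_vector) \<Rightarrow> bool" where
  "nagumo_tight M ys \<longleftrightarrow>
     (\<exists>h. nagumo_integrand M h \<and> (SUP n. \<integral>\<^sup>+w. e2ennreal (h w (ys n w)) \<partial>M) < \<infinity>)"

subsection \<open>Uniform integrability\<close>

text \<open>Elements of \<open>L\<^sub>1(M, \<real>)\<close> are represented by measurable extended-real-valued functions
  of finite norm, which are finite almost everywhere.\<close>

definition L1_norm :: "'w measure \<Rightarrow> ('w \<Rightarrow> ereal) \<Rightarrow> ennreal" where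
  "L1_norm M u = (\<integral>\<^sup>+w. e2ennreal \<bar>u w\<bar> \<partial>M)"

definition L1_bounded :: "'w measure \<Rightarrow> ('w \<Rightarrow> ereal) set \<Rightarrow> bool" where
  "L1_bounded M X \<longleftrightarrow> X \<subseteq> borel_measurable M \<and> (SUP u\<in>X. L1_norm M u) < \<infinity>"

definition equi_integrable :: "'w measure \<Rightarrow> ('w \<Rightarrow> ereal) set \<Rightarrow> bool" where
  "equi_integrable M X \<longleftrightarrow>
     (\<forall>\<epsilon>::real. \<epsilon> > 0 \<longrightarrow>
       (\<exists>\<eta>::real. \<exists>K. \<eta> > 0 \<and> K \<in> sets M \<and> emeasure M K < \<infinity> \<and>
         (\<forall>A\<in>sets M. emeasure M A \<le> ennreal \<eta> \<longrightarrow>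
            (SUP u\<in>X. L1_norm M (\<lambda>w. u w * indicator A w)) < ennreal \<epsilon>) \<and>
         (SUP u\<in>X. L1_norm M (\<lambda>w. u w * indicator (space M - K) w)) < ennreal \<epsilon>))"

definition uniformly_integrable :: "'w measure \<Rightarrow> ('w \<Rightarrow> ereal) set \<Rightarrow> bool" where
  "uniformly_integrable M X \<longleftrightarrow> L1_bounded M X \<and> equi_integrable M X"

definition negative_part :: "('w \<Rightarrow> ereal) \<Rightarrow> 'w \<Rightarrow> ereal" where
  "negative_part v w = max (- v w) 0"

definition lower_compactness ::
  "'w measure \<Rightarrow> ('w \<Rightarrow> 'e \<Rightarrow> 'f \<Rightarrow> ereal) \<Rightarrow> (nat \<Rightarrow> 'w \<Rightarrow> 'e) \<Rightarrow> (nat \<Rightarrow> 'w \<Rightarrow> 'f) \<Rightarrow> bool" where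
  "lower_compactness M f xs ys \<longleftrightarrow>
     (\<exists>n0. uniformly_integrable M
        ((\<lambda>n. negative_part (\<lambda>w. f w (xs n w) (ys n w))) ` {n0..}))"

end

theory Submission
  imports Defs "HOL-Library.Function_Algebras"
begin

text \<open>
  The inequality is proved without Young measures, by combining a pointwise inequality with Fatou's
  lemma along convex combinations. Suppose that \<open>I\<^sub>f(x\<^sub>n, y\<^sub>n) < l\<close> along a subsequence, and thin it out
  until \<open>x\<^sub>n \<rightarrow> x\<close> almost everywhere. Write \<open>v\<^sub>n = f(x\<^sub>n, y\<^sub>n)\<close>; these functions are integrable.

  \<^emph>\<open>Removing concentrations.\<close> The negative parts \<open>v\<^sub>n\<^sup>-\<close> are only bounded in \<open>L\<^sub>1\<close>. By the biting lemma
  (\<open>biting_lemma\<close>) a further subsequence is uniformly integrable off sets \<open>S\<^sub>k\<close> that decrease to a null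
  set. Since the \<open>k\<close>-th index of a subsequence is at least \<open>k\<close>, the definition of \<open>\<delta>\<^sup>+\<close> says that the
  part of \<open>\<integral>v\<^sub>k\<close> lost on \<open>S\<^sub>k\<close> is asymptotically at least \<open>-\<delta>\<^sup>+\<close>, so that
  \<open>\<integral>v'\<^sub>k \<le> l + \<delta>\<^sup>+ + \<epsilon>\<close> eventually, where \<open>v'\<^sub>k\<close> is \<open>v\<^sub>k\<close> cut off to the complement of \<open>S\<^sub>k\<close>.

  \<^emph>\<open>The pointwise inequality\<close> (\<open>eventually_affine_minorant\<close>). Let \<open>G\<^sub>k\<close> be the sum of the Nagumo
  integrand at \<open>y\<^sub>k\<close> and of a function that controls the uniform integrability. Its integrals are
  bounded. Fix \<open>\<omega>\<close>, a functional \<open>\<phi>\<close> and a real number \<open>c \<ge> (g\<^sub>\<omega>(x(\<omega>), \<cdot>))\<^sup>*(\<phi>)\<close>. Then for every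
  \<open>\<epsilon> > 0\<close> the bound \<open>v'\<^sub>k(\<omega>) + \<epsilon> G\<^sub>k(\<omega>) \<ge> \<phi>(y\<^sub>k(\<omega>)) - c - \<epsilon>\<close> holds for all large \<open>k\<close>. While \<open>y\<^sub>k(\<omega>)\<close> stays
  in a sublevel set of the Nagumo integrand, which is weakly compact, a violation for infinitely many
  \<open>k\<close> would give a weakly convergent subsequence contradicting the definition of \<open>g\<close>; outside a large
  sublevel set both \<open>\<phi>(y\<^sub>k(\<omega>))\<close> and the negative part of \<open>v'\<^sub>k(\<omega>)\<close> are at most a small multiple
  of \<open>G\<^sub>k(\<omega>)\<close>.

  \<^emph>\<open>Integration\<close> (\<open>lower_closure\<close>). The inequality is affine in \<open>y\<^sub>k(\<omega>)\<close>, hence survives convex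
  combinations. By Mazur's theorem (\<open>Mazur_L1\<close>, \<open>biting_convex_combinations\<close>) convex combinations of
  the tails of \<open>(y\<^sub>k)\<close> converge to \<open>y\<close> almost everywhere. The lower limit of the same combinations of
  \<open>v'\<^sub>k + \<epsilon> G\<^sub>k\<close> is therefore at least \<open>\<phi>(y(\<omega>)) - c\<close> for every \<open>\<phi>\<close> and \<open>c\<close>, that is, at least
  \<open>g\<^sub>\<omega>\<^sup>*\<^sup>*(x(\<omega>), y(\<omega>))\<close>. Passing to convex combinations first is what allows \<open>\<phi>\<close> to depend on \<open>\<omega>\<close>
  without any measurable selection. Fatou's lemma bounds the integral of this lower limit by
  \<open>l + \<delta>\<^sup>+ + O(\<epsilon>)\<close>, and it is a competitor in the upper integral of \<open>g\<^sup>*\<^sup>*(x, y)\<close>.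

  Finally, uniform integrability of the negative parts forces \<open>\<delta>\<^sup>+ = 0\<close>, which gives the second
  claim. The functional analysis needed above rests on one Hahn--Banach argument: a minimal sublinear
  functional is linear.
\<close>

section \<open>Sublinear functionals and separation\<close>

definition sublinear_on :: "'v::real_vector set \<Rightarrow> ('v \<Rightarrow> real) \<Rightarrow> bool" where
  "sublinear_on V p \<longleftrightarrow>
     (\<forall>u\<in>V. \<forall>v\<in>V. p (u + v) \<le> p u + p v) \<and> (\<forall>u\<in>V. \<forall>c>0. p (c *\<^sub>R u) = c * p u)"

lemma sublinear_onI:
  assumes "subspace V"
    and "\<And>u v. u \<in> V \<Longrightarrow> v \<in> V \<Longrightarrow> p (u + v) \<le> p u + p v"
    and le: "\<And>u c. u \<in> V \<Longrightarrow> 0 < c \<Longrightarrow> p (c *\<^sub>R u) \<le> c * p u"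
  shows "sublinear_on V p"
  unfolding sublinear_on_def
proof (intro conjI ballI allI impI)
  fix u :: 'a and c :: real assume u: "u \<in> V" and c: "0 < c"
  have "p (inverse c *\<^sub>R (c *\<^sub>R u)) \<le> inverse c * p (c *\<^sub>R u)"
    using le u c \<open>subspace V\<close> by (meson positive_imp_inverse_positive subspace_scale)
  then have "c * p u \<le> p (c *\<^sub>R u)"
    using c by (simp add: field_simps)
  then show "p (c *\<^sub>R u) = c * p u"
    using le[OF u c] by simp
qed (use assms in auto)

lemma sublinear_on_zero:
  assumes "sublinear_on V p" "subspace V"
  shows "p 0 = 0"
proof -
  have "\<forall>c>0. p (c *\<^sub>R 0) = c * p 0"
    using assms(1) subspace_0[OF assms(2)] unfolding sublinear_on_def by blast
  from this[rule_format, of 2] have "p 0 = 2 * p 0" by simp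
  then show ?thesis by simp
qed

lemma sublinear_on_minus:
  assumes "sublinear_on V p" "subspace V" "u \<in> V"
  shows "- p (- u) \<le> p u"
proof -
  have "p (u + - u) \<le> p u + p (- u)"
    using assms subspace_neg unfolding sublinear_on_def by blast
  then show ?thesis using sublinear_on_zero[OF assms(1,2)] by simp
qed

lemma sublinear_on_shift:
  assumes "sublinear_on V p" "subspace V" "u \<in> V" "w \<in> V"
  shows "p w \<le> p (u + w) + p (- u)"
proof -
  have "u + w \<in> V" "- u \<in> V" using assms subspace_add subspace_neg by auto
  then have "p ((u + w) + (- u)) \<le> p (u + w) + p (- u)"
    using assms unfolding sublinear_on_def by blast
  then show ?thesis by simp
qed

text \<open>
  Lowering \<open>p\<close> along the rays spanned by a convex set \<open>C\<close>, at the rate \<open>d\<close>, gives again a sublinear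
  functional: convexity makes the sum of two rays a ray, and \<open>d \<le> p\<close> on \<open>C\<close> keeps the infimum finite.
  With \<open>C\<close> a singleton this shows that minimal sublinear functionals are additive; with a general \<open>C\<close>
  it turns the Hahn--Banach theorem into a separation theorem.
\<close>

lemma sublinear_on_inf_rays:
  assumes p: "sublinear_on V p" and V: "subspace V" and C: "convex C" "C \<subseteq> V" "C \<noteq> {}"
    and d: "\<And>c. c \<in> C \<Longrightarrow> d \<le> p c"
  defines "q \<equiv> \<lambda>u. INF (t, c)\<in>{0..} \<times> C. p (u + t *\<^sub>R c) - t * d"
  shows "sublinear_on V q"
    and "\<And>u c t. u \<in> V \<Longrightarrow> c \<in> C \<Longrightarrow> 0 \<le> t \<Longrightarrow> q u \<le> p (u + t *\<^sub>R c) - t * d"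
proof -
  have lower: "- p (- u) \<le> p (u + t *\<^sub>R c) - t * d" if "c \<in> C" "0 \<le> t" "u \<in> V" for u c and t :: real
  proof (cases "t = 0")
    case True
    then show ?thesis using sublinear_on_minus[OF p V that(3)] by simp
  next
    case False
    have cV: "c \<in> V" using that C by auto
    have "p (t *\<^sub>R c) \<le> p (u + t *\<^sub>R c) + p (- u)"
      using sublinear_on_shift[OF p V that(3)] V cV subspace_scale by blast
    moreover have "p (t *\<^sub>R c) = t * p c"
      using p cV that False unfolding sublinear_on_def by auto
    moreover have "t * d \<le> t * p c"
      using d that by (intro mult_left_mono) auto
    ultimately show ?thesis by linarith
  qed
  have bdd: "bdd_below ((\<lambda>(t, c). p (u + t *\<^sub>R c) - t * d) ` ({0..} \<times> C))" if "u \<in> V" for u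
    using lower that by (intro bdd_belowI2[where m = "- p (- u)"]) auto
  show le: "q u \<le> p (u + t *\<^sub>R c) - t * d" if "u \<in> V" "c \<in> C" "0 \<le> t" for u c t
    unfolding q_def using that by (intro cINF_lower2[OF bdd, where x = "(t, c)"]) auto
  have ge: "m \<le> q u" if "u \<in> V" "\<And>c t. c \<in> C \<Longrightarrow> 0 \<le> t \<Longrightarrow> m \<le> p (u + t *\<^sub>R c) - t * d" for u m
    unfolding q_def using that C(3) by (intro cINF_greatest) auto
  have comb: "\<exists>c''\<in>C. t *\<^sub>R c + s *\<^sub>R c' = (t + s) *\<^sub>R c''"
    if "c \<in> C" "c' \<in> C" "0 \<le> t" "0 \<le> s" for c c' and t s :: real
  proof (cases "t + s = 0")
    case False
    let ?c = "(t / (t + s)) *\<^sub>R c + (s / (t + s)) *\<^sub>R c'"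
    have "?c \<in> C"
      using that False by (intro convexD[OF C(1)]) (auto simp: add_divide_distrib[symmetric])
    moreover have "t *\<^sub>R c + s *\<^sub>R c' = (t + s) *\<^sub>R ?c"
      using False by (simp add: scaleR_add_right)
    ultimately show ?thesis by blast
  next
    case True
    then have "t = 0" "s = 0" using that by linarith+
    then show ?thesis using that by auto
  qed
  have inV: "u + t *\<^sub>R c \<in> V" if "u \<in> V" "c \<in> C" for u c and t :: real
    using that C(2) V by (auto intro: subspace_add subspace_scale)
  show "sublinear_on V q"
  proof (rule sublinear_onI[OF V])
    fix u v assume uv: "u \<in> V" "v \<in> V"
    have "q (u + v) - (p (v + s *\<^sub>R c') - s * d) \<le> p (u + t *\<^sub>R c) - t * d"
      if cs: "c \<in> C" "c' \<in> C" "0 \<le> t" "0 \<le> s" for c c' s t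
    proof -
      obtain c'' where c'': "c'' \<in> C" "t *\<^sub>R c + s *\<^sub>R c' = (t + s) *\<^sub>R c''"
        using comb[OF cs] by blast
      have "q (u + v) \<le> p ((u + v) + (t + s) *\<^sub>R c'') - (t + s) * d"
        using le[of "u + v" c'' "t + s"] c'' cs uv V subspace_add by auto
      also have "(u + v) + (t + s) *\<^sub>R c'' = (u + t *\<^sub>R c) + (v + s *\<^sub>R c')"
        by (simp add: c''(2)[symmetric])
      also have "p \<dots> \<le> p (u + t *\<^sub>R c) + p (v + s *\<^sub>R c')"
        using p inV uv cs unfolding sublinear_on_def by blast
      finally show ?thesis by (simp add: algebra_simps)
    qed
    then have "q (u + v) - (p (v + s *\<^sub>R c') - s * d) \<le> q u" if "c' \<in> C" "0 \<le> s" for c' s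
      using that by (intro ge[OF uv(1)]) auto
    then have "q (u + v) - q u \<le> q v"
      by (intro ge[OF uv(2)]) (auto simp: algebra_simps)
    then show "q (u + v) \<le> q u + q v" by simp
  next
    fix u :: 'a and a :: real assume u: "u \<in> V" and a: "0 < a"
    have "q (a *\<^sub>R u) / a \<le> p (u + t *\<^sub>R c) - t * d" if "c \<in> C" "0 \<le> t" for c t
    proof -
      have "q (a *\<^sub>R u) \<le> p (a *\<^sub>R u + (a * t) *\<^sub>R c) - (a * t) * d"
        using le[of "a *\<^sub>R u" c "a * t"] that a u V subspace_scale by auto
      also have "a *\<^sub>R u + (a * t) *\<^sub>R c = a *\<^sub>R (u + t *\<^sub>R c)"
        by (simp add: scaleR_add_right)
      also have "p \<dots> = a * p (u + t *\<^sub>R c)"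
        using p inV[OF u that(1)] a unfolding sublinear_on_def by blast
      finally show ?thesis using a by (simp add: field_simps)
    qed
    then have "q (a *\<^sub>R u) / a \<le> q u" by (intro ge[OF u]) auto
    then show "q (a *\<^sub>R u) \<le> a * q u" using a by (simp add: field_simps)
  qed
qed

lemma sublinear_on_cong:
  assumes "sublinear_on V p" "subspace V" "\<And>u. u \<in> V \<Longrightarrow> q u = p u"
  shows "sublinear_on V q"
  using assms(1) assms(3) subspace_add[OF assms(2)] subspace_scale[OF assms(2)]
  unfolding sublinear_on_def by simp

text \<open>
  Lowering \<open>p\<close> along the ray of \<open>u\<close> at the rate \<open>p u\<close> must leave a minimal \<open>p\<close> unchanged, and this says
  that \<open>p v \<le> p (v + u) - p u\<close>.
\<close>

lemma minimal_sublinear_additive: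
  assumes p: "sublinear_on V p" and V: "subspace V"
    and min: "\<And>q. sublinear_on V q \<Longrightarrow> (\<forall>v\<in>V. q v \<le> p v) \<Longrightarrow> (\<forall>v\<in>V. q v = p v)"
    and u: "u \<in> V" and v: "v \<in> V"
  shows "p (u + v) = p u + p v"
proof -
  define q where "q = (\<lambda>w. INF (t, c)\<in>{0..} \<times> {u}. p (w + t *\<^sub>R c) - t * p u)"
  have q: "sublinear_on V q" "\<And>w t. w \<in> V \<Longrightarrow> 0 \<le> t \<Longrightarrow> q w \<le> p (w + t *\<^sub>R u) - t * p u"
    unfolding q_def using sublinear_on_inf_rays[OF p V, of "{u}" "p u"] u by auto
  have "q v = p v"
    using min[OF q(1)] q(2)[of _ 0] v by auto
  then have "p v \<le> p (v + u) - p u"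
    using q(2)[of v 1] v by simp
  moreover have "p (u + v) \<le> p u + p v"
    using p u v unfolding sublinear_on_def by blast
  ultimately show ?thesis by (simp add: add.commute)
qed

text \<open>
  Zorn's lemma yields a minimal sublinear functional below \<open>q\<close>, and minimal ones are linear. Functionals
  in the ordered set are set to zero off \<open>V\<close>, so that the pointwise order is antisymmetric on them.
\<close>

theorem Hahn_Banach_sublinear:
  assumes q: "sublinear_on V q" and V: "subspace V"
  obtains \<Phi> where "\<And>u v. u \<in> V \<Longrightarrow> v \<in> V \<Longrightarrow> \<Phi> (u + v) = \<Phi> u + \<Phi> v"
    and "\<And>u c. u \<in> V \<Longrightarrow> \<Phi> (c *\<^sub>R u) = c * \<Phi> u"
    and "\<And>u. u \<in> V \<Longrightarrow> \<Phi> u \<le> q u"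
proof -
  define A where "A = {p. sublinear_on V p \<and> (\<forall>u\<in>V. p u \<le> q u) \<and> (\<forall>u. u \<notin> V \<longrightarrow> p u = 0)}"
  have "\<exists>m\<in>A. \<forall>a\<in>A. a \<le> m \<longrightarrow> a = m"
  proof (rule predicate_Zorn)
    show "partial_order_on A (relation_of (\<lambda>p p'. p' \<le> p) A)"
      by (rule partial_order_on_relation_ofI) auto
    fix \<C> assume ch: "\<C> \<in> Chains (relation_of (\<lambda>p p'. p' \<le> p) A)"
    then have sub: "\<C> \<subseteq> A" and tot: "\<And>p p'. p \<in> \<C> \<Longrightarrow> p' \<in> \<C> \<Longrightarrow> p \<le> p' \<or> p' \<le> p"
      unfolding Chains_def relation_of_def by auto
    show "\<exists>p'\<in>A. \<forall>p\<in>\<C>. p' \<le> p"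
    proof (cases "\<C> = {}")
      case True
      have "(\<lambda>u. if u \<in> V then q u else 0) \<in> A"
        using sublinear_on_cong[OF q V] unfolding A_def by simp
      then show ?thesis using True by auto
    next
      case False
      define r where "r = (\<lambda>u. INF p\<in>\<C>. p u)"
      have bdd: "bdd_below ((\<lambda>p. p u) ` \<C>)" for u
      proof (cases "u \<in> V")
        case True
        show ?thesis
        proof (rule bdd_belowI2)
          fix p assume "p \<in> \<C>"
          then have "p \<in> A" using sub by auto
          then have "- p (- u) \<le> p u" "p (- u) \<le> q (- u)"
            using True V subspace_neg sublinear_on_minus unfolding A_def by blast+
          then show "- q (- u) \<le> p u" by linarith
        qed
      next
        case False
        then show ?thesis using sub unfolding A_def by (intro bdd_belowI2[where m = 0]) auto
      qed
      have lo: "r u \<le> p u" if "p \<in> \<C>" for p u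
        unfolding r_def by (intro cINF_lower bdd that)
      have gr: "m \<le> r u" if "\<And>p. p \<in> \<C> \<Longrightarrow> m \<le> p u" for m u
        unfolding r_def using False that by (intro cINF_greatest) auto
      have "r \<in> A"
        unfolding A_def
      proof (intro CollectI conjI ballI allI impI)
        obtain p0 where "p0 \<in> \<C>" using False by auto
        then show "r u \<le> q u" if "u \<in> V" for u
          using lo[of p0 u] sub that unfolding A_def by force
        show "r u = 0" if "u \<notin> V" for u
        proof -
          have "(\<lambda>p. p u) ` \<C> = (\<lambda>p. 0) ` \<C>"
            using sub that unfolding A_def by (intro image_cong) auto
          then show ?thesis using False unfolding r_def by simp
        qed
        show "sublinear_on V r"
        proof (rule sublinear_onI[OF V])
          fix u v assume uv: "u \<in> V" "v \<in> V"
          have "r (u + v) - p' v \<le> p u" if pp: "p \<in> \<C>" "p' \<in> \<C>" for p p'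
          proof -
            obtain p'' where p'': "p'' \<in> \<C>" "p'' \<le> p" "p'' \<le> p'"
              using tot[OF pp] pp by auto
            have "r (u + v) \<le> p'' (u + v)" by (rule lo[OF p''(1)])
            also have "\<dots> \<le> p'' u + p'' v"
              using sub p''(1) uv unfolding A_def sublinear_on_def by blast
            also have "\<dots> \<le> p u + p' v"
              using p''(2,3) by (intro add_mono) (auto simp: le_fun_def)
            finally show ?thesis by simp
          qed
          then have "r (u + v) - p' v \<le> r u" if "p' \<in> \<C>" for p'
            using that by (intro gr)
          then have "r (u + v) - r u \<le> r v"
            by (intro gr) (auto simp: algebra_simps)
          then show "r (u + v) \<le> r u + r v" by simp
        next
          fix u :: 'a and c :: real assume u: "u \<in> V" and c: "0 < c"
          have "r (c *\<^sub>R u) / c \<le> p u" if "p \<in> \<C>" for p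
            using lo[OF that, of "c *\<^sub>R u"] sub that u c
            unfolding A_def sublinear_on_def by (auto simp: field_simps)
          then have "r (c *\<^sub>R u) / c \<le> r u" by (intro gr)
          then show "r (c *\<^sub>R u) \<le> c * r u" using c by (simp add: field_simps)
        qed
      qed
      then show ?thesis using lo by (auto simp: le_fun_def)
    qed
  qed
  then obtain m where m: "m \<in> A" and min: "\<And>a. a \<in> A \<Longrightarrow> a \<le> m \<Longrightarrow> a = m" by blast
  have msub: "sublinear_on V m" and mq: "\<And>u. u \<in> V \<Longrightarrow> m u \<le> q u"
    using m unfolding A_def by auto
  have "\<forall>v\<in>V. p v = m v" if p: "sublinear_on V p" "\<forall>v\<in>V. p v \<le> m v" for p
  proof -
    have "(\<lambda>u. if u \<in> V then p u else 0) \<in> A"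
      using sublinear_on_cong[OF p(1) V] p(2) mq order_trans unfolding A_def by fastforce
    moreover have "(\<lambda>u. if u \<in> V then p u else 0) \<le> m"
      using p(2) m unfolding A_def by (auto simp: le_fun_def)
    ultimately have "(\<lambda>u. if u \<in> V then p u else 0) = m" by (rule min)
    then show ?thesis by (auto simp: fun_eq_iff split: if_splits)
  qed
  then have add: "m (u + v) = m u + m v" if "u \<in> V" "v \<in> V" for u v
    using minimal_sublinear_additive[OF msub V] that by blast
  have neg: "m (- u) = - m u" if "u \<in> V" for u
    using add[OF that subspace_neg[OF V that]] sublinear_on_zero[OF msub V] by simp
  have "m (c *\<^sub>R u) = c * m u" if u: "u \<in> V" for u c
  proof -
    have pos: "m (a *\<^sub>R u) = a * m u" if "0 < a" for a
      using msub u that unfolding sublinear_on_def by blast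
    consider "0 < c" | "c = 0" | "0 < - c" by linarith
    then show ?thesis
    proof cases
      case 3
      have "m (- ((- c) *\<^sub>R u)) = - m ((- c) *\<^sub>R u)"
        by (rule neg[OF subspace_scale[OF V u]])
      also have "\<dots> = c * m u" by (subst pos[OF 3]) simp
      finally show ?thesis by simp
    qed (use pos sublinear_on_zero[OF msub V] in auto)
  qed
  with add mq show ?thesis using that by blast
qed

text \<open>
  The lowered functional \<open>q\<close> satisfies \<open>q (- c) \<le> p 0 - d = - d\<close> for \<open>c \<in> C\<close>, so every linear functional
  below it is at least \<open>d\<close> on \<open>C\<close>.
\<close>

theorem seminorm_separation:
  assumes V: "subspace V" and p: "sublinear_on V p" and even: "\<And>u. u \<in> V \<Longrightarrow> p (- u) = p u"
    and C: "convex C" "C \<subseteq> V" and d: "\<And>c. c \<in> C \<Longrightarrow> d \<le> p c"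
  obtains \<Phi> where "\<And>u v. u \<in> V \<Longrightarrow> v \<in> V \<Longrightarrow> \<Phi> (u + v) = \<Phi> u + \<Phi> v"
    and "\<And>u c. u \<in> V \<Longrightarrow> \<Phi> (c *\<^sub>R u) = c * \<Phi> u"
    and "\<And>u. u \<in> V \<Longrightarrow> \<bar>\<Phi> u\<bar> \<le> p u"
    and "\<And>c. c \<in> C \<Longrightarrow> d \<le> \<Phi> c"
proof (cases "C = {}")
  case True
  obtain \<Phi> where \<Phi>: "\<And>u v. u \<in> V \<Longrightarrow> v \<in> V \<Longrightarrow> \<Phi> (u + v) = \<Phi> u + \<Phi> v"
    "\<And>u c. u \<in> V \<Longrightarrow> \<Phi> (c *\<^sub>R u) = c * \<Phi> u" "\<And>u. u \<in> V \<Longrightarrow> \<Phi> u \<le> p u"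
    using Hahn_Banach_sublinear[OF p V] by blast
  have "\<bar>\<Phi> u\<bar> \<le> p u" if "u \<in> V" for u
    using \<Phi>(3)[of u] \<Phi>(3)[of "- u"] \<Phi>(2)[of u "-1"] even that V subspace_neg by (auto simp: abs_le_iff)
  with \<Phi> that True show ?thesis by blast
next
  case False
  define q where "q = (\<lambda>u. INF (t, c)\<in>{0..} \<times> C. p (u + t *\<^sub>R c) - t * d)"
  have q: "sublinear_on V q" "\<And>u c t. u \<in> V \<Longrightarrow> c \<in> C \<Longrightarrow> 0 \<le> t \<Longrightarrow> q u \<le> p (u + t *\<^sub>R c) - t * d"
    unfolding q_def using sublinear_on_inf_rays[OF p V C False, of d] d by auto
  obtain \<Phi> where \<Phi>: "\<And>u v. u \<in> V \<Longrightarrow> v \<in> V \<Longrightarrow> \<Phi> (u + v) = \<Phi> u + \<Phi> v"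
    "\<And>u c. u \<in> V \<Longrightarrow> \<Phi> (c *\<^sub>R u) = c * \<Phi> u" "\<And>u. u \<in> V \<Longrightarrow> \<Phi> u \<le> q u"
    using Hahn_Banach_sublinear[OF q(1) V] by blast
  obtain c0 where c0: "c0 \<in> C" using False by auto
  have le: "\<Phi> u \<le> p u" if "u \<in> V" for u
    using \<Phi>(3)[OF that] q(2)[OF that c0, of 0] by simp
  have neg: "\<Phi> (- u) = - \<Phi> u" if "u \<in> V" for u
    using \<Phi>(2)[OF that, of "-1"] by simp
  have "\<bar>\<Phi> u\<bar> \<le> p u" if "u \<in> V" for u
    using le[of u] le[of "- u"] neg that even V subspace_neg by (auto simp: abs_le_iff)
  moreover have "d \<le> \<Phi> c" if "c \<in> C" for c
  proof -
    have cV: "c \<in> V" "- c \<in> V" using that C V subspace_neg by auto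
    have "\<Phi> (- c) \<le> p (- c + 1 *\<^sub>R c) - 1 * d"
      using \<Phi>(3)[OF cV(2)] q(2)[OF cV(2) that, of 1] by simp
    then show ?thesis using neg[OF cV(1)] sublinear_on_zero[OF p V] by simp
  qed
  ultimately show ?thesis using \<Phi> that by blast
qed

section \<open>Mazur's theorem in the space of integrable functions\<close>

text \<open>
  With the pointwise vector space structure, the integrable functions form a subspace on which the
  \<open>L\<^sub>1\<close>-norm is a seminorm, so that the separation theorem applies without passing to classes.
\<close>

instantiation "fun" :: (type, real_vector) real_vector
begin

definition scaleR_fun_def: "c *\<^sub>R u = (\<lambda>w. c *\<^sub>R u w)"

instance
  by standard (simp_all add: scaleR_fun_def fun_eq_iff scaleR_add_right scaleR_add_left)

end

lemma scaleR_fun_apply [simp]: "(c *\<^sub>R u) w = c *\<^sub>R u w"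
  by (simp add: scaleR_fun_def)

lemma sum_fun_apply: "(\<Sum>i\<in>I. g i) w = (\<Sum>i\<in>I. g i w)"
  by (induction I rule: infinite_finite_induct) auto

lemma limitin_sigma_topology_mem:
  assumes "limitin (sigma_topology X D) us u sequentially"
  shows "u \<in> X"
  using limitin_topspace[OF assms] unfolding sigma_topology_def by auto

lemma limitin_sigma_topology_apply:
  assumes lim: "limitin (sigma_topology X D) us u sequentially" and \<phi>: "\<phi> \<in> D"
  shows "(\<lambda>n. \<phi> (us n)) \<longlonglongrightarrow> \<phi> u"
proof (rule topological_tendstoI)
  fix U assume "open U" "\<phi> u \<in> U"
  then have "openin (sigma_topology X D) {x \<in> X. \<phi> x \<in> U}"
    unfolding sigma_topology_def using \<phi> by (intro topology_generated_by_Basis) blast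
  then show "\<forall>\<^sub>F n in sequentially. \<phi> (us n) \<in> U"
    using lim limitin_sigma_topology_mem[OF lim] \<open>\<phi> u \<in> U\<close>
    unfolding limitin_def by (auto elim!: eventually_mono)
qed

text \<open>
  Otherwise the convex hull of the differences \<open>ys i - y\<close> with \<open>i \<ge> n\<close> stays at distance \<open>e\<close> from the
  origin, and a continuous functional that is at least \<open>e\<close> on it contradicts weak convergence.
\<close>

lemma Mazur_L1:
  fixes ys :: "nat \<Rightarrow> 'w \<Rightarrow> 'f::{banach, second_countable_topology}"
  assumes int: "\<And>n. integrable N (ys n)"
    and lim: "limitin (weak_L1_topology N) ys y sequentially" and e: "0 < e"
  obtains I c where "finite I" "I \<subseteq> {n..}" "\<And>i. i \<in> I \<Longrightarrow> 0 \<le> c i" "sum c I = (1::real)"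
    and "(\<integral>w. norm ((\<Sum>i\<in>I. c i *\<^sub>R ys i w) - y w) \<partial>N) < e"
proof (rule ccontr)
  assume contra: "\<not> thesis"
  note thI = that
  let ?V = "{u :: 'w \<Rightarrow> 'f. integrable N u}"
  let ?p = "\<lambda>u :: 'w \<Rightarrow> 'f. \<integral>w. norm (u w) \<partial>N"
  let ?z = "\<lambda>i. ys i - y"
  let ?C = "convex hull (?z ` {n..})"
  have V: "subspace ?V"
    by (auto simp: subspace_def plus_fun_def scaleR_fun_def zero_fun_def)
  have p: "sublinear_on ?V ?p"
  proof (rule sublinear_onI[OF V])
    fix u v :: "'w \<Rightarrow> 'f" assume uv: "u \<in> ?V" "v \<in> ?V"
    then have "?p (u + v) \<le> (\<integral>w. norm (u w) + norm (v w) \<partial>N)"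
      by (intro integral_mono) (auto intro: norm_triangle_ineq simp: plus_fun_def)
    then show "?p (u + v) \<le> ?p u + ?p v"
      using uv by simp
  qed simp
  have y: "integrable N y"
    using limitin_sigma_topology_mem[OF lim[unfolded weak_L1_topology_def]] by simp
  have zV: "?z i \<in> ?V" for i
    using int[of i] y by (simp add: fun_diff_def)
  have CV: "?C \<subseteq> ?V"
    using zV V by (intro hull_minimal subspace_imp_convex) auto
  have "e \<le> ?p u" if uC: "u \<in> ?C" for u
  proof -
    obtain Z a where Z: "finite Z" "Z \<subseteq> ?z ` {n..}" "\<And>v. v \<in> Z \<Longrightarrow> 0 \<le> a v" "sum a Z = 1"
      and u: "(\<Sum>v\<in>Z. a v *\<^sub>R v) = u"
      using uC unfolding convex_hull_explicit by auto
    obtain I where I: "I \<subseteq> {n..}" "inj_on ?z I" "Z = ?z ` I"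
      using Z(2) unfolding subset_image_inj by auto
    have fin: "finite I" using Z(1) I(2,3) finite_imageD by blast
    have sum1: "sum (\<lambda>i. a (?z i)) I = 1"
      using Z(4) I by (simp add: sum.reindex)
    have "u w = (\<Sum>i\<in>I. a (?z i) *\<^sub>R ys i w) - y w" for w
    proof -
      have "u w = (\<Sum>i\<in>I. a (?z i) *\<^sub>R (ys i w - y w))"
        using u I by (auto simp: sum.reindex sum_fun_apply)
      also have "\<dots> = (\<Sum>i\<in>I. a (?z i) *\<^sub>R ys i w) - sum (\<lambda>i. a (?z i)) I *\<^sub>R y w"
        by (simp add: scaleR_diff_right sum_subtractf scaleR_sum_left)
      finally show ?thesis using sum1 by simp
    qed
    then have "?p u = (\<integral>w. norm ((\<Sum>i\<in>I. a (?z i) *\<^sub>R ys i w) - y w) \<partial>N)" by simp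
    moreover have "0 \<le> a (?z i)" if "i \<in> I" for i using Z(3) I(3) that by auto
    ultimately show ?thesis
      using contra thI[OF fin I(1) _ sum1] by fastforce
  qed
  then obtain \<Phi> where \<Phi>: "\<And>u v. u \<in> ?V \<Longrightarrow> v \<in> ?V \<Longrightarrow> \<Phi> (u + v) = \<Phi> u + \<Phi> v"
    "\<And>u c. u \<in> ?V \<Longrightarrow> \<Phi> (c *\<^sub>R u) = c * \<Phi> u" "\<And>u. u \<in> ?V \<Longrightarrow> \<bar>\<Phi> u\<bar> \<le> ?p u"
    "\<And>u. u \<in> ?C \<Longrightarrow> e \<le> \<Phi> u"
    using seminorm_separation[OF V p _ convex_convex_hull CV, of e] by auto
  have "\<Phi> \<in> L1_dual N"
    unfolding L1_dual_def
    using \<Phi>(1)[unfolded plus_fun_def] \<Phi>(2)[unfolded scaleR_fun_def] \<Phi>(3)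
    by (auto intro!: exI[of _ 1])
  then have "(\<lambda>i. \<Phi> (ys i)) \<longlonglongrightarrow> \<Phi> y"
    using limitin_sigma_topology_apply[OF lim[unfolded weak_L1_topology_def]] by blast
  then have "(\<lambda>i. \<Phi> (ys i) - \<Phi> y) \<longlonglongrightarrow> 0"
    by (simp add: LIM_zero)
  then have "\<forall>\<^sub>F i in sequentially. \<Phi> (ys i) - \<Phi> y < e"
    using e by (rule order_tendstoD)
  then obtain i where i: "i \<ge> n" "\<Phi> (ys i) - \<Phi> y < e"
    unfolding eventually_sequentially by (meson nle_le)
  have "\<Phi> (?z i + y) = \<Phi> (?z i) + \<Phi> y"
    using zV[of i] y by (intro \<Phi>(1)) auto
  moreover have "?z i + y = ys i" by simp
  moreover have "e \<le> \<Phi> (?z i)" using i(1) by (intro \<Phi>(4) hull_inc) auto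
  ultimately show False using i(2) by simp
qed

text \<open>
  One sequence of convex combinations serves for all the sets \<open>\<Omega> k\<close> of Biting convergence at once: the
  \<open>n\<close>-th one is chosen within \<open>2\<^sup>-\<^sup>n\<close> of \<open>y\<close> in \<open>L\<^sub>1\<close> of \<open>\<Omega> n\<close>. The errors are then summable almost
  everywhere on the union, because a point of \<open>\<Omega> k\<close> lies in \<open>\<Omega> n\<close> for all \<open>n \<ge> k\<close>.
\<close>

lemma biting_convex_combinations:
  fixes ys :: "nat \<Rightarrow> 'w \<Rightarrow> 'f::{banach, second_countable_topology}"
  assumes bit: "biting_converges M ys y"
    and ys [measurable]: "\<And>n. ys n \<in> borel_measurable M" and y [measurable]: "y \<in> borel_measurable M"
  obtains I and c :: "nat \<Rightarrow> nat \<Rightarrow> real" where "\<And>n. finite (I n)" "\<And>n. I n \<subseteq> {n..}"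
    and "\<And>n i. i \<in> I n \<Longrightarrow> 0 \<le> c n i" "\<And>n. sum (c n) (I n) = 1"
    and "AE w in M. (\<lambda>n. \<Sum>i\<in>I n. c n i *\<^sub>R ys i w) \<longlonglongrightarrow> y w"
proof -
  obtain \<Omega> where \<Omega> [measurable]: "\<And>k. \<Omega> k \<in> sets M" and inc: "incseq \<Omega>"
    and null: "space M - (\<Union>k. \<Omega> k) \<in> null_sets M"
    and int: "\<And>k n. integrable (restrict_space M (\<Omega> k)) (ys n)"
    and lim: "\<And>k. limitin (weak_L1_topology (restrict_space M (\<Omega> k))) ys y sequentially"
    using bit unfolding biting_converges_def by blast
  define P where "P = (\<lambda>n I c. finite I \<and> I \<subseteq> {n..} \<and> (\<forall>i\<in>I. 0 \<le> c i) \<and> sum c I = (1::real) \<and>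
      (\<integral>w. norm ((\<Sum>i\<in>I. c i *\<^sub>R ys i w) - y w) \<partial>restrict_space M (\<Omega> n)) < (1/2) ^ n)"
  have "\<exists>I c. P n I c" for n
  proof -
    have "(0::real) < (1/2) ^ n" by simp
    then obtain I c where "finite I" "I \<subseteq> {n..}" "\<And>i. i \<in> I \<Longrightarrow> 0 \<le> c i" "sum c I = (1::real)"
      "(\<integral>w. norm ((\<Sum>i\<in>I. c i *\<^sub>R ys i w) - y w) \<partial>restrict_space M (\<Omega> n)) < (1/2) ^ n"
      using Mazur_L1[OF int lim, where e = "(1/2) ^ n"] by blast
    then have "P n I c" unfolding P_def by simp
    then show ?thesis by blast
  qed
  then obtain I c where "\<And>n. P n (I n) (c n)" by metis
  then have Ic: "\<And>n. finite (I n)" "\<And>n. I n \<subseteq> {n..}" "\<And>n i. i \<in> I n \<Longrightarrow> 0 \<le> c n i"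
    "\<And>n. sum (c n) (I n) = (1::real)"
    and small: "\<And>n. (\<integral>w. norm ((\<Sum>i\<in>I n. c n i *\<^sub>R ys i w) - y w) \<partial>restrict_space M (\<Omega> n)) < (1/2) ^ n"
    unfolding P_def by auto
  define Y where "Y = (\<lambda>n w. \<Sum>i\<in>I n. c n i *\<^sub>R ys i w)"
  have Ym [measurable]: "Y n \<in> borel_measurable M" for n unfolding Y_def by measurable
  define D where "D = (\<lambda>n w. norm (Y n w - y w) * indicator (\<Omega> n) w)"
  have Dm [measurable]: "D n \<in> borel_measurable M" for n unfolding D_def by measurable
  have D_int: "(\<integral>\<^sup>+w. ennreal (D n w) \<partial>M) \<le> ennreal ((1/2) ^ n)" for n
  proof -
    have yi: "integrable (restrict_space M (\<Omega> n)) y"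
      using limitin_sigma_topology_mem[OF lim[of n, unfolded weak_L1_topology_def]] by simp
    have "integrable (restrict_space M (\<Omega> n)) (\<lambda>w. norm (Y n w - y w))"
      unfolding Y_def using int yi by auto
    then have "(\<integral>\<^sup>+w. ennreal (norm (Y n w - y w)) \<partial>restrict_space M (\<Omega> n))
        = ennreal (\<integral>w. norm (Y n w - y w) \<partial>restrict_space M (\<Omega> n))"
      by (intro nn_integral_eq_integral) auto
    also have "\<dots> \<le> ennreal ((1/2) ^ n)"
      using small[of n] unfolding Y_def by (intro ennreal_leI) simp
    finally have "(\<integral>\<^sup>+w. ennreal (norm (Y n w - y w)) * indicator (\<Omega> n) w \<partial>M) \<le> ennreal ((1/2) ^ n)"
      using \<Omega>[of n] by (subst (asm) nn_integral_restrict_space) auto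
    then show ?thesis
      unfolding D_def by (simp add: ennreal_mult'' ennreal_indicator)
  qed
  have "(\<integral>\<^sup>+w. (\<Sum>n. ennreal (D n w)) \<partial>M) = (\<Sum>n. \<integral>\<^sup>+w. ennreal (D n w) \<partial>M)"
    by (rule nn_integral_suminf) measurable
  also have "\<dots> \<le> (\<Sum>n. ennreal ((1/2) ^ n))"
    by (intro suminf_le D_int) auto
  also have "\<dots> = ennreal (\<Sum>n. (1/2) ^ n)"
    by (intro suminf_ennreal2) auto
  also have "\<dots> < \<infinity>" by simp
  finally have "AE w in M. (\<Sum>n. ennreal (D n w)) \<noteq> \<infinity>"
    by (intro nn_integral_noteq_infinite) auto
  moreover have "AE w in M. w \<in> (\<Union>k. \<Omega> k)"
    using AE_not_in[OF null] by (auto elim!: AE_mp intro!: AE_I2)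
  ultimately have "AE w in M. (\<lambda>n. Y n w) \<longlonglongrightarrow> y w"
  proof eventually_elim
    case (elim w)
    then obtain k where k: "w \<in> \<Omega> k" by auto
    have "summable (\<lambda>n. D n w)"
      using elim(1) by (intro summable_suminf_not_top) (auto simp: D_def)
    then have "(\<lambda>n. D n w) \<longlonglongrightarrow> 0" by (rule summable_LIMSEQ_zero)
    moreover have "\<forall>\<^sub>F n in sequentially. D n w = norm (Y n w - y w)"
      using eventually_ge_at_top[of k]
    proof eventually_elim
      case (elim n)
      then have "w \<in> \<Omega> n" using k incseqD[OF inc] by auto
      then show ?case by (simp add: D_def)
    qed
    ultimately have "(\<lambda>n. norm (Y n w - y w)) \<longlonglongrightarrow> 0"
      by (rule Lim_transform_eventually)
    then show ?case
      by (simp add: tendsto_norm_zero_iff LIM_zero_iff)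
  qed
  then show ?thesis using that[OF Ic] unfolding Y_def by blast
qed

section \<open>Weakly compact sets and growth of Nagumo integrands\<close>

lemma continuous_map_weak_blinfun:
  "continuous_map weak_topology euclideanreal (blinfun_apply (\<phi> :: 'f::real_normed_vector \<Rightarrow>\<^sub>L real))"
proof -
  have "openin weak_topology {e. blinfun_apply \<phi> e \<in> U}" if "open U" for U
    unfolding weak_topology_def sigma_topology_def
    using that by (intro topology_generated_by_Basis) auto
  moreover have "topspace (weak_topology :: 'f topology) = UNIV"
  proof -
    have "UNIV \<in> {{x \<in> UNIV. \<phi> x \<in> U} |(\<phi> :: 'f \<Rightarrow> real) U. \<phi> \<in> range blinfun_apply \<and> open U}"
      by (intro CollectI exI[of _ "blinfun_apply (0 :: 'f \<Rightarrow>\<^sub>L real)"] exI[of _ UNIV]) auto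
    then show ?thesis unfolding weak_topology_def sigma_topology_def topology_generated_by_topspace by blast
  qed
  ultimately show ?thesis
    by (auto simp: continuous_map_def)
qed

lemma norming_functional:
  fixes e :: "'f::real_normed_vector"
  obtains \<phi> :: "'f \<Rightarrow>\<^sub>L real" where "\<And>u. \<bar>blinfun_apply \<phi> u\<bar> \<le> norm u" "blinfun_apply \<phi> e = norm e"
proof -
  have "sublinear_on UNIV (norm :: 'f \<Rightarrow> real)"
    by (rule sublinear_onI) (auto intro: norm_triangle_ineq)
  note sep = seminorm_separation[OF subspace_UNIV this, of "{e}" "norm e"]
  show ?thesis
  proof (rule sep)
    fix \<Phi> :: "'f \<Rightarrow> real"
    assume \<Phi>: "\<And>u v. u \<in> UNIV \<Longrightarrow> v \<in> UNIV \<Longrightarrow> \<Phi> (u + v) = \<Phi> u + \<Phi> v"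
      "\<And>u c. u \<in> UNIV \<Longrightarrow> \<Phi> (c *\<^sub>R u) = c * \<Phi> u"
      "\<And>u. u \<in> UNIV \<Longrightarrow> \<bar>\<Phi> u\<bar> \<le> norm u" "\<And>c. c \<in> {e} \<Longrightarrow> norm e \<le> \<Phi> c"
    have "bounded_linear \<Phi>"
      using \<Phi>(1-3) by (intro bounded_linear_intro[where K = 1]) auto
    then have "blinfun_apply (Blinfun \<Phi>) = \<Phi>" by (rule bounded_linear_Blinfun_apply)
    moreover have "\<Phi> e = norm e" using \<Phi>(3)[of e] \<Phi>(4)[of e] by simp
    ultimately show thesis using that[of "Blinfun \<Phi>"] \<Phi>(3) by simp
  qed auto
qed

text \<open>
  The norming functionals of a dense sequence separate points: if all of them vanish at \<open>u\<close>, then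
  \<open>norm (d m) \<le> norm (d m - u)\<close> for every member of the dense sequence, which fails for \<open>d m\<close> close to a
  nonzero \<open>u\<close>.
\<close>

lemma separating_sequence:
  obtains \<phi> :: "nat \<Rightarrow> 'f::{real_normed_vector, second_countable_topology} \<Rightarrow>\<^sub>L real"
  where "\<And>u. (\<And>m. blinfun_apply (\<phi> m) u = 0) \<Longrightarrow> u = 0"
proof -
  obtain D :: "'f set" where D: "countable D" "\<And>X. open X \<Longrightarrow> X \<noteq> {} \<Longrightarrow> \<exists>d\<in>D. d \<in> X"
    using countable_dense_exists by blast
  have "D \<noteq> {}" using D(2)[of UNIV] by auto
  define d where "d = from_nat_into D"
  have "\<exists>\<phi> :: 'f \<Rightarrow>\<^sub>L real. (\<forall>u. \<bar>blinfun_apply \<phi> u\<bar> \<le> norm u) \<and> blinfun_apply \<phi> (d m) = norm (d m)" for m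
    using norming_functional[of "d m"] by metis
  then obtain \<phi> :: "nat \<Rightarrow> 'f \<Rightarrow>\<^sub>L real" where
    \<phi>: "\<And>m u. \<bar>blinfun_apply (\<phi> m) u\<bar> \<le> norm u" "\<And>m. blinfun_apply (\<phi> m) (d m) = norm (d m)"
    by metis
  have "u = 0" if u: "\<And>m. blinfun_apply (\<phi> m) u = 0" for u
  proof (rule ccontr)
    assume "u \<noteq> 0"
    then obtain x where "x \<in> D" "x \<in> ball u (norm u / 2)"
      using D(2)[of "ball u (norm u / 2)"] by auto
    then obtain m where m: "dist u (d m) < norm u / 2"
      using from_nat_into_surj[OF D(1)] unfolding d_def by fastforce
    have "norm (d m) = \<bar>blinfun_apply (\<phi> m) (d m - u)\<bar>"
      using \<phi>(2) u by (simp add: blinfun.diff_right)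
    also have "\<dots> \<le> norm (d m - u)" by (rule \<phi>(1))
    finally have "norm (d m) < norm u / 2" using m by (simp add: dist_norm norm_minus_commute)
    moreover have "norm u \<le> norm (d m) + dist u (d m)"
      by (metis dist_norm norm_triangle_sub)
    ultimately show False using m by linarith
  qed
  then show ?thesis using that by blast
qed

text \<open>
  A separating sequence of functionals maps a weakly compact set continuously and injectively, hence
  homeomorphically, onto a compact subset of the metrizable space of real sequences.
\<close>

theorem weakly_compact_imp_sequentially_compact:
  fixes b :: "nat \<Rightarrow> 'f::{real_normed_vector, second_countable_topology}"
  assumes K: "compactin weak_topology K" and b: "\<And>n. b n \<in> K"
  obtains l r where "strict_mono (r :: nat \<Rightarrow> nat)" "limitin weak_topology (b \<circ> r) l sequentially"
proof -
  obtain \<phi> :: "nat \<Rightarrow> 'f \<Rightarrow>\<^sub>L real" where \<phi>: "\<And>u. (\<And>m. blinfun_apply (\<phi> m) u = 0) \<Longrightarrow> u = 0"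
    using separating_sequence by blast
  define J where "J = (\<lambda>e m. blinfun_apply (\<phi> m) e)"
  let ?X = "subtopology weak_topology K"
  have J: "continuous_map weak_topology euclidean J"
    unfolding J_def euclidean_product_topology[symmetric] continuous_map_componentwise_UNIV
    using continuous_map_weak_blinfun by blast
  have Ktop: "topspace ?X = K"
    using K compactin_subset_topspace by auto
  have "inj_on J K"
  proof (rule inj_onI)
    fix u v assume "J u = J v"
    then have "blinfun_apply (\<phi> m) (u - v) = 0" for m
      by (simp add: J_def blinfun.diff_right fun_eq_iff)
    then show "u = v" using \<phi>[of "u - v"] by simp
  qed
  then have "homeomorphic_map ?X (top_of_set (J ` K)) J"
    using K J Ktop
    by (intro continuous_imp_homeomorphic_map)
      (auto simp: compact_space_subtopology Hausdorff_space_subtopology continuous_map_in_subtopology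
        intro: continuous_map_from_subtopology)
  then obtain g where g: "continuous_map (top_of_set (J ` K)) ?X g" "\<And>e. e \<in> K \<Longrightarrow> g (J e) = e"
    unfolding homeomorphic_map_maps homeomorphic_maps_def Ktop by auto
  have "compact (J ` K)"
    using image_compactin[OF K J] by simp
  then obtain l r where l: "l \<in> J ` K" and r: "strict_mono (r :: nat \<Rightarrow> nat)" "((\<lambda>n. J (b n)) \<circ> r) \<longlonglongrightarrow> l"
    using seq_compactE[of "J ` K" "\<lambda>n. J (b n)"] b unfolding compact_eq_seq_compact_metric by blast
  have "limitin (top_of_set (J ` K)) ((\<lambda>n. J (b n)) \<circ> r) l sequentially"
    using l r b by (auto simp: limitin_subtopology)
  from continuous_map_limit[OF g(1) this]
  have "limitin ?X (b \<circ> r) (g l) sequentially"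
    using g(2) b by (simp add: comp_def)
  then show ?thesis using r(1) that by (auto simp: limitin_subtopology)
qed

text \<open>
  Superlinear growth of a Nagumo integrand in each direction. Where \<open>h \<ge> \<phi> / \<delta>\<close> there is nothing to do;
  the remaining points lie in a weakly compact sublevel set of \<open>h - \<phi> / \<delta>\<close>, on which \<open>\<phi> / \<delta>\<close> is bounded.
\<close>

lemma nagumo_growth:
  fixes h :: "'f::real_normed_vector \<Rightarrow> ereal"
  assumes comp: "\<And>(\<phi> :: 'f \<Rightarrow>\<^sub>L real) r::real. compactin weak_topology {e. h e - ereal (blinfun_apply \<phi> e) \<le> ereal r}"
    and pos: "\<And>e. 0 \<le> h e" and \<delta>: "0 < \<delta>"
  obtains R where "\<And>e. ereal R < h e \<Longrightarrow> ereal (blinfun_apply \<phi> e) \<le> ereal \<delta> * h e"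
proof -
  define \<psi> where "\<psi> = (1 / \<delta>) *\<^sub>R \<phi>"
  let ?K = "{e. h e - ereal (blinfun_apply \<psi> e) \<le> ereal 0}"
  have "compact (blinfun_apply \<psi> ` ?K)"
    using image_compactin[OF comp continuous_map_weak_blinfun] by simp
  then obtain B where B: "\<And>e. e \<in> ?K \<Longrightarrow> blinfun_apply \<psi> e \<le> B"
    using compact_imp_bounded bounded_imp_bdd_above unfolding bdd_above_def by (metis imageI)
  have "ereal (blinfun_apply \<phi> e) \<le> ereal \<delta> * h e" if R: "ereal B < h e" for e
  proof -
    have "ereal (blinfun_apply \<psi> e) \<le> h e"
    proof (cases "e \<in> ?K")
      case True
      then show ?thesis using B[of e] R by (metis ereal_less_eq(3) order_trans less_imp_le)
    next
      case False
      then show ?thesis using pos[of e] by (cases "h e") auto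
    qed
    then have "ereal \<delta> * ereal (blinfun_apply \<psi> e) \<le> ereal \<delta> * h e"
      using \<delta> by (intro ereal_mult_left_mono) auto
    then show ?thesis using \<delta> by (simp add: \<psi>_def blinfun.scaleR_left)
  qed
  then show ?thesis using that by blast
qed

section \<open>The pointwise lower bound\<close>

lemma conjugate_le_iff:
  "conjugate k \<phi> \<le> ereal c \<longleftrightarrow> (\<forall>e. ereal (blinfun_apply \<phi> e) - ereal c \<le> k e)"
proof -
  have "ereal (blinfun_apply \<phi> e) - k e \<le> ereal c \<longleftrightarrow> ereal (blinfun_apply \<phi> e) - ereal c \<le> k e" for e
    by (cases "k e") auto
  then show ?thesis unfolding conjugate_def by (simp add: SUP_le_iff)
qed

text \<open>
  The biconjugate is the supremum of the continuous affine minorants. Letting \<open>c\<close> range over all reals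
  above the conjugate also covers the value \<open>-\<infinity>\<close> of the conjugate.
\<close>

lemma biconjugate_le:
  assumes "\<And>\<phi> c. conjugate k \<phi> \<le> ereal c \<Longrightarrow> ereal (blinfun_apply \<phi> e - c) \<le> u"
  shows "biconjugate k e \<le> u"
  unfolding biconjugate_def
proof (rule SUP_least)
  fix \<phi> :: "'a \<Rightarrow>\<^sub>L real"
  show "ereal (blinfun_apply \<phi> e) - conjugate k \<phi> \<le> u"
  proof (cases "conjugate k \<phi>")
    case (real c)
    then show ?thesis using assms[of \<phi> c] by simp
  next
    case MInf
    have "ereal B \<le> u" for B
      using assms[of \<phi> "blinfun_apply \<phi> e - B"] MInf by simp
    then have "u = \<infinity>" by (rule ereal_top)
    then show ?thesis by simp
  qed simp
qed

text \<open>
  If the inequality failed infinitely often, a subsequence of the offending \<open>b n\<close> would converge weakly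
  to some \<open>l\<close>, and the sequential regularization at \<open>(e, l)\<close> would be at most \<open>\<phi> l - c - \<epsilon>\<close>, against the
  choice of \<open>c\<close>.
\<close>

lemma eventually_affine_minorant_on_sublevel:
  fixes f :: "'w \<Rightarrow> 'e::topological_space \<Rightarrow> 'f::{real_normed_vector, second_countable_topology} \<Rightarrow> ereal"
  assumes K: "compactin weak_topology K" and a: "a \<longlonglongrightarrow> e"
    and c: "conjugate (seq_regularization f w e) \<phi> \<le> ereal c" and \<epsilon>: "0 < \<epsilon>"
  shows "\<forall>\<^sub>F n in sequentially. b n \<in> K \<longrightarrow> ereal (blinfun_apply \<phi> (b n) - c - \<epsilon>) \<le> f w (a n) (b n)"
proof (rule ccontr)
  let ?bad = "\<lambda>n. b n \<in> K \<and> f w (a n) (b n) < ereal (blinfun_apply \<phi> (b n) - c - \<epsilon>)"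
  assume "\<not> ?thesis"
  then have "\<exists>\<^sub>F n in sequentially. ?bad n"
    by (simp add: not_eventually not_le)
  then have "infinite {n. ?bad n}"
    unfolding frequently_cofinite[symmetric] cofinite_eq_sequentially .
  then obtain r where r: "strict_mono (r :: nat \<Rightarrow> nat)" "\<And>n. ?bad (r n)"
    using infinite_enumerate[of "{n. ?bad n}"] by auto
  obtain l s where s: "strict_mono (s :: nat \<Rightarrow> nat)" "limitin weak_topology ((b \<circ> r) \<circ> s) l sequentially"
  proof (rule weakly_compact_imp_sequentially_compact[OF K, of "b \<circ> r"])
    show "(b \<circ> r) n \<in> K" for n using r(2) by simp
  qed
  have rs: "strict_mono (r \<circ> s)" using r(1) s(1) by (rule strict_mono_o)
  define a' b' where "a' = a \<circ> (r \<circ> s)" and "b' = b \<circ> (r \<circ> s)"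
  have a': "a' \<longlonglongrightarrow> e" unfolding a'_def by (rule LIMSEQ_subseq_LIMSEQ[OF a rs])
  have b': "limitin weak_topology b' l sequentially" using s(2) by (simp add: b'_def comp_assoc)
  have "ereal (blinfun_apply \<phi> l) - ereal c \<le> seq_regularization f w e l"
    using c unfolding conjugate_le_iff by blast
  also have "\<dots> \<le> liminf (\<lambda>n. f w (a' n) (b' n))"
    unfolding seq_regularization_def using a' b' by (intro Inf_lower) blast
  also have "\<dots> \<le> liminf (\<lambda>n. ereal (blinfun_apply \<phi> (b' n) - c - \<epsilon>))"
    using r(2) by (intro Liminf_mono always_eventually) (auto simp: a'_def b'_def intro: less_imp_le)
  also have "\<dots> = ereal (blinfun_apply \<phi> l - c - \<epsilon>)"
  proof (rule lim_imp_Liminf)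
    have "limitin euclideanreal (blinfun_apply \<phi> \<circ> b') (blinfun_apply \<phi> l) sequentially"
      by (rule continuous_map_limit[OF continuous_map_weak_blinfun b'])
    then have "(\<lambda>n. blinfun_apply \<phi> (b' n)) \<longlonglongrightarrow> blinfun_apply \<phi> l" by (simp add: comp_def)
    then show "(\<lambda>n. ereal (blinfun_apply \<phi> (b' n) - c - \<epsilon>)) \<longlonglongrightarrow> ereal (blinfun_apply \<phi> l - c - \<epsilon>)"
      by (intro tendsto_ereal tendsto_diff tendsto_const)
  qed simp
  finally show False using \<epsilon> by simp
qed

text \<open>
  Here \<open>G n\<close> dominates the Nagumo integrand at \<open>b n\<close>, and assumption \<open>ui\<close> is the pointwise trace of the
  uniform integrability of the negative parts. Above a level \<open>R\<close> of \<open>h\<close>, where \<open>G n\<close> is large, the three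
  terms \<open>\<phi> (b n)\<close>, the negative part of \<open>v n\<close> and the constants are absorbed by \<open>\<epsilon> * G n\<close>.
\<close>

lemma eventually_affine_minorant:
  fixes f :: "'w \<Rightarrow> 'e::topological_space \<Rightarrow> 'f::{real_normed_vector, second_countable_topology} \<Rightarrow> ereal"
    and G v :: "nat \<Rightarrow> real"
  assumes comp: "\<And>(\<psi> :: 'f \<Rightarrow>\<^sub>L real) r::real. compactin weak_topology {e. h e - ereal (blinfun_apply \<psi> e) \<le> ereal r}"
    and pos: "\<And>e. 0 \<le> h e" and a: "a \<longlonglongrightarrow> e"
    and c: "conjugate (seq_regularization f w e) \<phi> \<le> ereal c"
    and v: "\<forall>\<^sub>F n in sequentially. f w (a n) (b n) = ereal (v n)"
    and G: "\<And>n. h (b n) \<le> ereal (G n)"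
    and ui: "\<And>\<delta>. 0 < \<delta> \<Longrightarrow> \<exists>B. \<forall>\<^sub>F n in sequentially. - (\<delta> * G n + B) \<le> v n"
    and \<epsilon>: "0 < \<epsilon>"
  shows "\<forall>\<^sub>F n in sequentially. blinfun_apply \<phi> (b n) - c - \<epsilon> \<le> v n + \<epsilon> * G n"
proof -
  have \<epsilon>4: "0 < \<epsilon> / 4" using \<epsilon> by simp
  obtain B where B: "\<forall>\<^sub>F n in sequentially. - (\<epsilon>/4 * G n + B) \<le> v n"
    using ui[OF \<epsilon>4] by blast
  obtain R0 where R0: "\<And>e. ereal R0 < h e \<Longrightarrow> ereal (blinfun_apply \<phi> e) \<le> ereal (\<epsilon>/4) * h e"
    using nagumo_growth[OF comp pos \<epsilon>4] by blast
  \<comment> \<open>Beyond this level the constants \<open>B\<close> and \<open>c\<close> are at most a quarter of \<open>\<epsilon> * G n\<close>.\<close>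
  define R where "R = max R0 (max 1 (4 * (\<bar>B\<bar> + \<bar>c\<bar>) / \<epsilon>))"
  have "compactin weak_topology {e. h e \<le> ereal R}"
    using comp[of 0 R] by simp
  from eventually_affine_minorant_on_sublevel[where f = f and w = w and b = b, OF this a c \<epsilon>]
  show ?thesis using v B
  proof eventually_elim
    case (elim n)
    have G0: "0 \<le> G n" using pos[of "b n"] G[of n] by (metis ereal_less_eq(5) order_trans)
    show ?case
    proof (cases "h (b n) \<le> ereal R")
      case True
      moreover have "0 \<le> \<epsilon> * G n" using G0 \<epsilon> by simp
      ultimately show ?thesis using elim(1,2) by simp
    next
      case False
      then have R: "ereal R < h (b n)" by simp
      then have "ereal R0 < h (b n)" unfolding R_def by (metis ereal_less_eq(3) le_less_trans max.cobounded1)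
      then have "ereal (blinfun_apply \<phi> (b n)) \<le> ereal (\<epsilon>/4) * h (b n)" by (rule R0)
      also have "\<dots> \<le> ereal (\<epsilon>/4) * ereal (G n)"
        using \<epsilon> by (intro ereal_mult_left_mono G) auto
      finally have 1: "blinfun_apply \<phi> (b n) \<le> \<epsilon>/4 * G n" by simp
      have "ereal R < ereal (G n)" using R G[of n] by (rule less_le_trans)
      then have "4 * (\<bar>B\<bar> + \<bar>c\<bar>) / \<epsilon> \<le> G n" unfolding R_def by simp
      then have 2: "\<bar>B\<bar> + \<bar>c\<bar> \<le> \<epsilon>/4 * G n" using \<epsilon> by (simp add: field_simps)
      have "0 \<le> \<epsilon> * G n" using G0 \<epsilon> by simp
      then show ?thesis using elim(3) 1 2 \<epsilon> by linarith
    qed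
  qed
qed

section \<open>The biting lemma\<close>

lemma frequently_subsequence:
  assumes "\<And>k. \<exists>\<^sub>F n in sequentially. P k n"
  obtains r where "strict_mono (r :: nat \<Rightarrow> nat)" "\<And>k. P k (r k)"
proof -
  have ex: "\<exists>n>m. P k n" for m k
    using assms[of k] unfolding frequently_sequentially by (meson Suc_le_eq)
  have "\<exists>r. \<forall>k. P k (r k) \<and> r k < r (Suc k)"
    by (rule dependent_nat_choice) (use ex in auto)
  then show ?thesis using that strict_mono_Suc_iff by blast
qed

text \<open>
  In the application \<open>J n t\<close> is the integral of the \<open>n\<close>-th function over the set where it exceeds
  \<open>t\<close> times a fixed weight. Let \<open>d\<close> be the limit, as \<open>t\<close> grows, of the upper limit of \<open>J n t\<close> in \<open>n\<close>: the
  mass that concentrates. Levels \<open>m j\<close> beyond which the upper limit is within \<open>4\<^sup>-\<^sup>j\<close> of \<open>d\<close>, and indices \<open>r k\<close>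
  for which \<open>J (r k) (m k)\<close> still has almost the mass \<open>d\<close>, leave mass at most \<open>2 * 4\<^sup>-\<^sup>j\<close> between the
  levels \<open>m j\<close> and \<open>m k\<close>.
\<close>

lemma biting_selection:
  fixes J :: "nat \<Rightarrow> real \<Rightarrow> real"
  assumes anti: "\<And>n s t. s \<le> t \<Longrightarrow> J n t \<le> J n s"
    and J0: "\<And>n t. 0 \<le> J n t" and C: "\<And>n t. J n t \<le> C"
  obtains r m where "strict_mono (r :: nat \<Rightarrow> nat)" "mono m" "\<And>k::nat. 2 ^ k \<le> m k"
    and "\<And>j k. j \<le> k \<Longrightarrow> J (r k) (m j) - J (r k) (m k) \<le> 2 * (1/4) ^ j"
proof -
  define T where "T = {t. \<exists>s. \<forall>\<^sub>F n in sequentially. J n s < t}"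
  have "C + 1 \<in> T"
    unfolding T_def using C by (intro CollectI exI[of _ 0] always_eventually) (smt (verit))
  then have "T \<noteq> {}" by auto
  have "bdd_below T"
  proof (rule bdd_belowI)
    fix t assume "t \<in> T"
    then obtain s where "\<forall>\<^sub>F n in sequentially. J n s < t" unfolding T_def by auto
    then obtain n where "J n s < t" by (auto simp: eventually_sequentially)
    then show "0 \<le> t" using J0[of n s] by linarith
  qed
  define d where "d = Inf T"
  have up: "\<exists>s. \<forall>\<^sub>F n in sequentially. J n s < d + (1/4) ^ j" for j
  proof -
    have "Inf T < d + (1/4) ^ j" unfolding d_def by simp
    then obtain t where "t \<in> T" "t < d + (1/4) ^ j"
      using \<open>T \<noteq> {}\<close> \<open>bdd_below T\<close> cInf_less_iff by metis
    then obtain s where "\<forall>\<^sub>F n in sequentially. J n s < t" unfolding T_def by auto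
    then show ?thesis
      using \<open>t < _\<close> by (auto intro!: exI[of _ s] elim!: eventually_mono)
  qed
  then obtain N where N: "\<And>j. \<forall>\<^sub>F n in sequentially. J n (N j) < d + (1/4) ^ j" by metis
  have lo: "\<exists>\<^sub>F n in sequentially. d - (1/4) ^ k \<le> J n s" for k s
  proof (rule ccontr)
    assume "\<not> ?thesis"
    then have "\<forall>\<^sub>F n in sequentially. J n s < d - (1/4) ^ k" by (simp add: not_frequently not_le)
    then have "d - (1/4) ^ k \<in> T" unfolding T_def by auto
    then have "d \<le> d - (1/4) ^ k" unfolding d_def using \<open>bdd_below T\<close> by (rule cInf_lower)
    then show False using zero_less_power[of "1/4::real" k] by linarith
  qed
  \<comment> \<open>Summing the thresholds makes the levels monotone; the powers of two make the tail sets summable.\<close>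
  define m where "m = (\<lambda>j::nat. 2 ^ j + (\<Sum>i\<le>j. \<bar>N i\<bar>))"
  have mono: "mono m"
    unfolding m_def by (intro monoI add_mono power_increasing sum_mono2) auto
  have mN: "N j \<le> m j" for j
  proof -
    have "\<bar>N j\<bar> \<le> (\<Sum>i\<le>j. \<bar>N i\<bar>)" by (rule member_le_sum) auto
    moreover have "(0::real) \<le> 2 ^ j" by simp
    ultimately show ?thesis unfolding m_def by linarith
  qed
  have "\<exists>\<^sub>F n in sequentially. d - (1/4) ^ k \<le> J n (m k) \<and> (\<forall>j\<in>{..k}. J n (m j) < d + (1/4) ^ j)" for k
  proof (rule frequently_eventually_frequently[OF lo])
    show "\<forall>\<^sub>F n in sequentially. \<forall>j\<in>{..k}. J n (m j) < d + (1/4) ^ j"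
    proof (rule eventually_ball_finite)
      have "\<forall>\<^sub>F n in sequentially. J n (m j) < d + (1/4) ^ j" for j
        using N[of j] by eventually_elim (rule le_less_trans[OF anti[OF mN]])
      then show "\<forall>j\<in>{..k}. \<forall>\<^sub>F n in sequentially. J n (m j) < d + (1/4) ^ j" by blast
    qed simp
  qed
  then obtain r where r: "strict_mono (r :: nat \<Rightarrow> nat)"
    "\<And>k. d - (1/4) ^ k \<le> J (r k) (m k) \<and> (\<forall>j\<in>{..k}. J (r k) (m j) < d + (1/4) ^ j)"
    using frequently_subsequence[where P = "\<lambda>k n. d - (1/4) ^ k \<le> J n (m k) \<and> (\<forall>j\<in>{..k}. J n (m j) < d + (1/4) ^ j)"]
    by blast
  have "J (r k) (m j) - J (r k) (m k) \<le> 2 * (1/4) ^ j" if "j \<le> k" for j k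
  proof -
    have "((1/4) ^ k :: real) \<le> (1/4) ^ j" using that by (intro power_decreasing) auto
    moreover have "J (r k) (m j) < d + (1/4) ^ j" "d - (1/4) ^ k \<le> J (r k) (m k)"
      using r(2)[of k] that by auto
    ultimately show ?thesis by linarith
  qed
  moreover have "2 ^ k \<le> m k" for k unfolding m_def by (simp add: sum_nonneg)
  ultimately show ?thesis using that r(1) mono by blast
qed

text \<open>
  Each function is cut above the level \<open>m k * p\<close>. The sets \<open>A (r k) (m k)\<close> removed in this way have weights
  \<open>\<integral>p\<close> at most \<open>C / 2\<^sup>k\<close>, so their tail unions \<open>S k\<close> decrease to a null set. What remains has mass at most
  \<open>2 * 4\<^sup>-\<^sup>j\<close> between the levels \<open>m j\<close> and \<open>m k\<close>. Weighting these pieces by \<open>2\<^sup>j\<close> gives functions \<open>G k\<close> with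
  bounded integrals, against which the remainder is small: this is uniform integrability in the
  style of de la Vallee Poussin, and the form in which it can be used pointwise.
\<close>

theorem biting_lemma:
  fixes a :: "nat \<Rightarrow> 'w \<Rightarrow> real" and p :: "'w \<Rightarrow> real"
  assumes a: "\<And>n. integrable M (a n)" and a0: "\<And>n w. w \<in> space M \<Longrightarrow> 0 \<le> a n w" and aC: "\<And>n. (\<integral>w. a n w \<partial>M) \<le> C"
    and p: "integrable M p" and p0: "\<And>w. w \<in> space M \<Longrightarrow> 0 < p w"
  obtains r S and G :: "nat \<Rightarrow> 'w \<Rightarrow> real"
  where "strict_mono (r :: nat \<Rightarrow> nat)"
    and "\<And>k. S k \<in> sets M" "decseq S" "(\<Inter>k. S k) \<in> null_sets M"
    and "\<And>k. integrable M (G k)" "\<And>k w. w \<in> space M \<Longrightarrow> 0 \<le> G k w" "\<And>k. (\<integral>w. G k w \<partial>M) \<le> 4"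
    and "\<And>\<epsilon>. 0 < \<epsilon> \<Longrightarrow> \<exists>B\<ge>0. \<forall>k. \<forall>w\<in>space M - S k. a (r k) w \<le> \<epsilon> * G k w + B * p w"
proof -
  note [measurable] = borel_measurable_integrable[OF a] borel_measurable_integrable[OF p]
  define A where "A = (\<lambda>n t. {w \<in> space M. t * p w < a n w})"
  have A [measurable]: "A n t \<in> sets M" for n t unfolding A_def by measurable
  define J where "J = (\<lambda>n t. \<integral>w. a n w * indicator (A n t) w \<partial>M)"
  have int: "integrable M (\<lambda>w. a n w * indicator (A n t) w)" for n t
    by (rule integrable_real_mult_indicator[OF A a])
  have anti: "J n t \<le> J n s" if "s \<le> t" for n s t
    unfolding J_def
  proof (rule integral_mono[OF int int])
    fix w assume w: "w \<in> space M"
    have "s * p w \<le> t * p w" using that p0[OF w] by (intro mult_right_mono) auto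
    then show "a n w * indicator (A n t) w \<le> a n w * indicator (A n s) w"
      using a0[OF w, of n] by (auto simp: indicator_def A_def)
  qed
  have J0: "0 \<le> J n t" for n t
    unfolding J_def using a0 by (intro integral_nonneg_AE AE_I2) (auto simp: indicator_def)
  have JC: "J n t \<le> C" for n t
  proof -
    have "J n t \<le> (\<integral>w. a n w \<partial>M)"
      unfolding J_def using a0 by (intro integral_mono[OF int a]) (auto simp: indicator_def)
    then show ?thesis using aC[of n] by simp
  qed
  obtain r m where r: "strict_mono (r :: nat \<Rightarrow> nat)" and m: "mono m" "\<And>k::nat. 2 ^ k \<le> m k"
    and diff: "\<And>j k. j \<le> k \<Longrightarrow> J (r k) (m j) - J (r k) (m k) \<le> 2 * (1/4) ^ j"
    using biting_selection[of J C] anti J0 JC by blast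
  have mpos: "0 < m k" for k using m(2)[of k] by (smt (verit) zero_less_power)
  define S where "S = (\<lambda>k. \<Union>j\<in>{k..}. A (r j) (m j))"
  have S [measurable]: "S k \<in> sets M" for k unfolding S_def by measurable
  have dec: "decseq S" unfolding S_def by (intro decseq_SucI) (auto dest: Suc_leD)
  have pA: "(\<integral>\<^sup>+w. ennreal (p w) * indicator (A (r j) (m j)) w \<partial>M) \<le> ennreal (C * (1/2) ^ j)" for j
  proof -
    have "(\<integral>\<^sup>+w. ennreal (p w) * indicator (A (r j) (m j)) w \<partial>M) \<le> (\<integral>\<^sup>+w. ennreal (a (r j) w / m j) \<partial>M)"
    proof (rule nn_integral_mono)
      fix w assume w: "w \<in> space M"
      show "ennreal (p w) * indicator (A (r j) (m j)) w \<le> ennreal (a (r j) w / m j)"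
        using mpos[of j] by (auto simp: indicator_def A_def field_simps intro!: ennreal_leI)
    qed
    also have "\<dots> = ennreal (\<integral>w. a (r j) w / m j \<partial>M)"
      using a a0 mpos by (intro nn_integral_eq_integral AE_I2) (auto simp: less_imp_le)
    also have "\<dots> \<le> ennreal (C * (1/2) ^ j)"
    proof (rule ennreal_leI)
      have C0: "0 \<le> C" using J0[of 0 0] JC[of 0 0] by linarith
      have "(\<integral>w. a (r j) w / m j \<partial>M) = (\<integral>w. a (r j) w \<partial>M) / m j" by simp
      also have "\<dots> \<le> C / m j" using aC mpos by (simp add: divide_right_mono less_imp_le)
      also have "\<dots> \<le> C / 2 ^ j" using C0 m(2)[of j] mpos[of j] by (intro divide_left_mono) auto
      finally show "(\<integral>w. a (r j) w / m j \<partial>M) \<le> C * (1/2) ^ j" by (simp add: power_one_over)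
    qed
    finally show ?thesis .
  qed
  have "AE w in M. (\<Sum>j. ennreal (p w) * indicator (A (r j) (m j)) w) \<noteq> \<infinity>"
  proof (rule nn_integral_noteq_infinite)
    have C0: "0 \<le> C" using J0[of 0 0] JC[of 0 0] by linarith
    have "(\<integral>\<^sup>+w. (\<Sum>j. ennreal (p w) * indicator (A (r j) (m j)) w) \<partial>M)
        = (\<Sum>j. \<integral>\<^sup>+w. ennreal (p w) * indicator (A (r j) (m j)) w \<partial>M)"
      by (rule nn_integral_suminf) measurable
    also have "\<dots> \<le> (\<Sum>j. ennreal (C * (1/2) ^ j))"
      by (intro suminf_le pA) auto
    also have "\<dots> = ennreal (\<Sum>j. C * (1/2) ^ j)"
      using C0 by (intro suminf_ennreal2 summable_mult summable_geometric) auto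
    finally show "(\<integral>\<^sup>+w. (\<Sum>j. ennreal (p w) * indicator (A (r j) (m j)) w) \<partial>M) \<noteq> \<infinity>"
      by (auto simp: top_unique)
  qed measurable
  then have "AE w in M. w \<notin> (\<Inter>k. S k)"
  proof (rule AE_mp, intro AE_I2 impI notI)
    fix w assume w: "w \<in> space M" and fin: "(\<Sum>j. ennreal (p w) * indicator (A (r j) (m j)) w) \<noteq> \<infinity>"
      and inS: "w \<in> (\<Inter>k. S k)"
    have "summable (\<lambda>j. p w * indicator (A (r j) (m j)) w)"
      using fin p0[OF w]
      by (intro summable_suminf_not_top) (auto simp: ennreal_mult'' ennreal_indicator)
    then have "(\<lambda>j. p w * indicator (A (r j) (m j)) w) \<longlonglongrightarrow> 0" by (rule summable_LIMSEQ_zero)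
    then have "\<forall>\<^sub>F j in sequentially. p w * indicator (A (r j) (m j)) w < p w"
      using p0[OF w] by (rule order_tendstoD)
    then obtain k where k: "\<And>j. k \<le> j \<Longrightarrow> p w * indicator (A (r j) (m j)) w < p w"
      by (auto simp: eventually_sequentially)
    obtain j where "k \<le> j" "w \<in> A (r j) (m j)" using inS unfolding S_def by blast
    then show False using k[of j] by simp
  qed
  then have null: "(\<Inter>k. S k) \<in> null_sets M"
    by (subst (asm) AE_iff_null_sets[symmetric]) measurable
  \<comment> \<open>The \<open>j\<close>-th summand is \<open>2 ^ j\<close> times the function restricted to values between the levels \<open>m j\<close> and \<open>m k\<close>.\<close>
  define G where "G = (\<lambda>k w. \<Sum>j<k. 2 ^ j * (a (r k) w * indicator (A (r k) (m j)) w - a (r k) w * indicator (A (r k) (m k)) w))"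
  have G_int: "integrable M (G k)" for k
    unfolding G_def by (intro Bochner_Integration.integrable_sum integrable_mult_right Bochner_Integration.integrable_diff int)
  have term0: "0 \<le> a (r k) w * indicator (A (r k) (m j)) w - a (r k) w * indicator (A (r k) (m k)) w"
    if "w \<in> space M" "j \<le> k" for j k w
  proof -
    have "m j * p w \<le> m k * p w"
      using p0[OF that(1)] monoD[OF m(1) that(2)] by (intro mult_right_mono) auto
    then show ?thesis using a0[OF that(1), of "r k"] by (auto simp: indicator_def A_def)
  qed
  have G0: "0 \<le> G k w" if "w \<in> space M" for k w
    unfolding G_def using term0[OF that] by (intro sum_nonneg mult_nonneg_nonneg) auto
  have G4: "(\<integral>w. G k w \<partial>M) \<le> 4" for k
  proof -
    have "(\<integral>w. G k w \<partial>M) = (\<Sum>j<k. 2 ^ j * (J (r k) (m j) - J (r k) (m k)))"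
      unfolding G_def J_def using int by (simp add: integral_sum)
    also have "\<dots> \<le> (\<Sum>j<k. 2 ^ j * (2 * (1/4) ^ j))"
      using diff by (intro sum_mono mult_left_mono) auto
    also have "\<dots> = (\<Sum>j<k. 2 * (1/2) ^ j)"
      by (intro sum.cong) (auto simp: power_mult_distrib[symmetric])
    also have "\<dots> = 2 * (\<Sum>j<k. (1/2) ^ j)" by (simp add: sum_distrib_left)
    also have "\<dots> \<le> 4" by (simp add: sum_gp_strict)
    finally show ?thesis .
  qed
  have bound: "\<exists>B\<ge>0. \<forall>k. \<forall>w\<in>space M - S k. a (r k) w \<le> \<epsilon> * G k w + B * p w" if \<epsilon>: "0 < \<epsilon>" for \<epsilon>
  proof -
    obtain j where j: "(1/2) ^ j < \<epsilon>" using real_arch_pow_inv[OF \<epsilon>, of "1/2"] by auto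
    have "a (r k) w \<le> \<epsilon> * G k w + m j * p w" if w: "w \<in> space M" "w \<notin> S k" for k w
    proof -
      have notA: "w \<notin> A (r k) (m k)" using w(2) unfolding S_def by auto
      then have le: "a (r k) w \<le> m k * p w" using w(1) unfolding A_def by auto
      have eG: "0 \<le> \<epsilon> * G k w" using G0[OF w(1)] \<epsilon> by simp
      have pw: "0 \<le> p w" using p0[OF w(1)] by simp
      consider "w \<notin> A (r k) (m j)" | "k \<le> j" | "j < k" "w \<in> A (r k) (m j)" by linarith
      then show ?thesis
      proof cases
        case 1
        then show ?thesis using eG w(1) unfolding A_def by auto
      next
        case 2
        have "m k * p w \<le> m j * p w" using monoD[OF m(1) 2] pw by (intro mult_right_mono)
        then show ?thesis using le eG by linarith
      next
        case 3
        have "2 ^ j * a (r k) w = 2 ^ j * (a (r k) w * indicator (A (r k) (m j)) w - a (r k) w * indicator (A (r k) (m k)) w)"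
          using notA 3 by simp
        also have "\<dots> \<le> G k w"
          unfolding G_def using 3 term0[OF w(1)] by (intro member_le_sum mult_nonneg_nonneg) auto
        finally have "a (r k) w \<le> (1/2) ^ j * G k w"
          by (simp add: power_one_over field_simps)
        also have "\<dots> \<le> \<epsilon> * G k w" using j G0[OF w(1)] by (intro mult_right_mono) auto
        finally show ?thesis using mpos[of j] pw by (simp add: add_increasing2)
      qed
    qed
    then show ?thesis using mpos[of j] by (intro exI[of _ "m j"]) auto
  qed
  show ?thesis
    by (rule that[OF r S dec null G_int G0 G4 bound])
qed

section \<open>Fatou's lemma along convex combinations\<close>

lemma outer_integral_le:
  assumes "integrable M u" "AE w in M. v w \<le> ereal (u w)"
  shows "outer_integral M v \<le> ereal (\<integral>w. u w \<partial>M)"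
  unfolding outer_integral_def using assms by (intro INF_lower) auto

lemma integral_le_outer_integral:
  assumes "integrable M u" "AE w in M. ereal (u w) \<le> v w"
  shows "ereal (\<integral>w. u w \<partial>M) \<le> outer_integral M v"
  unfolding outer_integral_def
proof (rule INF_greatest, clarify)
  fix z assume z: "integrable M z" "AE w in M. v w \<le> ereal (z w)"
  from assms(2) z(2) have "AE w in M. u w \<le> z w"
    by eventually_elim (metis ereal_less_eq(3) order_trans)
  then show "ereal (\<integral>w. u w \<partial>M) \<le> ereal (\<integral>w. z w \<partial>M)"
    using integral_mono_AE[OF assms(1) z(1)] by simp
qed

lemma le_enn2realI:
  assumes "ennreal t \<le> z" "z \<noteq> \<infinity>"
  shows "t \<le> enn2real z"
  using assms by (cases z) (auto simp: ennreal_le_iff2)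

text \<open>
  By \<open>affine\<close> and \<open>conv\<close>, the lower limit of the convex combinations of \<open>v n + \<epsilon> * G n\<close> dominates every
  affine minorant of \<open>k w\<close> at \<open>y w\<close>, hence the biconjugate. Assumption \<open>ui\<close> provides the integrable
  minorant that Fatou's lemma requires, and the error \<open>\<epsilon> * C\<close> disappears as \<open>\<epsilon>\<close> tends to zero.
\<close>

theorem lower_closure:
  fixes v G :: "nat \<Rightarrow> 'w \<Rightarrow> real" and ys :: "nat \<Rightarrow> 'w \<Rightarrow> 'f::{banach, second_countable_topology}"
    and I :: "nat \<Rightarrow> nat set" and c :: "nat \<Rightarrow> nat \<Rightarrow> real" and p :: "'w \<Rightarrow> real"
  assumes v: "\<And>n. integrable M (v n)"
    and G: "\<And>n. integrable M (G n)" "\<And>n w. w \<in> space M \<Longrightarrow> 0 \<le> G n w" "\<And>n. (\<integral>w. G n w \<partial>M) \<le> C"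
    and p: "integrable M p"
    and I: "\<And>n. finite (I n)" "\<And>n. I n \<subseteq> {n..}"
    and c: "\<And>n i. i \<in> I n \<Longrightarrow> 0 \<le> c n i" "\<And>n. sum (c n) (I n) = 1"
    and conv: "AE w in M. (\<lambda>n. \<Sum>i\<in>I n. c n i *\<^sub>R ys i w) \<longlonglongrightarrow> y w"
    and ui: "\<And>\<epsilon>. 0 < \<epsilon> \<Longrightarrow> \<exists>B. AE w in M. \<forall>n. - (\<epsilon> * G n w + B * p w) \<le> v n w"
    and affine: "AE w in M. \<forall>\<phi> d \<epsilon>. conjugate (k w) \<phi> \<le> ereal d \<longrightarrow> 0 < \<epsilon> \<longrightarrow>
      (\<forall>\<^sub>F n in sequentially. blinfun_apply \<phi> (ys n w) - d - \<epsilon> \<le> v n w + \<epsilon> * G n w)"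
    and l: "\<forall>\<^sub>F n in sequentially. (\<integral>w. v n w \<partial>M) \<le> l"
  shows "outer_integral M (\<lambda>w. biconjugate (k w) (y w)) \<le> ereal l"
proof -
  have main: "outer_integral M (\<lambda>w. biconjugate (k w) (y w)) \<le> ereal (l + \<epsilon> * C)" if \<epsilon>: "0 < \<epsilon>" for \<epsilon>
  proof -
    obtain B where B: "AE w in M. \<forall>n. - (\<epsilon> * G n w + B * p w) \<le> v n w" using ui[OF \<epsilon>] by blast
    define W where "W = (\<lambda>n w. v n w + \<epsilon> * G n w + B * p w)"
    have W: "integrable M (W n)" for n unfolding W_def using v G(1) p by auto
    define V where "V = (\<lambda>n w. \<Sum>i\<in>I n. c n i * W i w)"
    have V: "integrable M (V n)" for n unfolding V_def using W by auto
    note [measurable] = borel_measurable_integrable[OF V] borel_measurable_integrable[OF p]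
    from B have V0: "AE w in M. \<forall>n. 0 \<le> V n w"
    proof eventually_elim
      case (elim w)
      have "0 \<le> W n w" for n using elim[rule_format, of n] unfolding W_def by linarith
      then show ?case unfolding V_def using c by (auto intro!: sum_nonneg)
    qed
    let ?t = "l + \<epsilon> * C + B * (\<integral>w. p w \<partial>M)"
    obtain N where N: "\<And>n. N \<le> n \<Longrightarrow> (\<integral>w. v n w \<partial>M) \<le> l"
      using l by (auto simp: eventually_sequentially)
    have Vle: "(\<integral>w. V n w \<partial>M) \<le> ?t" if "N \<le> n" for n
    proof -
      have "(\<integral>w. V n w \<partial>M) = (\<Sum>i\<in>I n. c n i * (\<integral>w. W i w \<partial>M))"
        unfolding V_def using W by (subst Bochner_Integration.integral_sum) auto
      also have "\<dots> \<le> (\<Sum>i\<in>I n. c n i * ?t)"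
      proof (intro sum_mono mult_left_mono c)
        fix i assume "i \<in> I n"
        then have "N \<le> i" using I(2)[of n] that by auto
        have "(\<integral>w. W i w \<partial>M) = (\<integral>w. v i w \<partial>M) + \<epsilon> * (\<integral>w. G i w \<partial>M) + B * (\<integral>w. p w \<partial>M)"
          unfolding W_def using v G(1) p by simp
        then show "(\<integral>w. W i w \<partial>M) \<le> ?t"
          using N[OF \<open>N \<le> i\<close>] G(3)[of i] \<epsilon> by (simp add: add_mono)
      qed
      also have "\<dots> = ?t" using c(2)[of n] by (simp add: sum_distrib_right[symmetric])
      finally show ?thesis .
    qed
    have V_int0: "0 \<le> (\<integral>w. V n w \<partial>M)" for n
      using V0 by (intro integral_nonneg_AE) auto
    then have t0: "0 \<le> ?t" using Vle[of N] order_trans by blast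
    define Z where "Z = (\<lambda>w. liminf (\<lambda>n. ennreal (V n w)))"
    have [measurable]: "Z \<in> borel_measurable M" unfolding Z_def by measurable
    have "(\<integral>\<^sup>+w. Z w \<partial>M) \<le> liminf (\<lambda>n. \<integral>\<^sup>+w. ennreal (V n w) \<partial>M)"
      unfolding Z_def by (rule nn_integral_liminf) measurable
    also have "\<dots> = liminf (\<lambda>n. ennreal (\<integral>w. V n w \<partial>M))"
      using V V0 by (subst nn_integral_eq_integral) auto
    also have "\<dots> \<le> limsup (\<lambda>n. ennreal (\<integral>w. V n w \<partial>M))"
      by (rule Liminf_le_Limsup) simp
    also have "\<dots> \<le> ennreal ?t"
    proof (rule Limsup_bounded)
      show "\<forall>\<^sub>F n in sequentially. ennreal (\<integral>w. V n w \<partial>M) \<le> ennreal ?t"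
        using eventually_ge_at_top[of N] by eventually_elim (intro ennreal_leI Vle)
    qed
    finally have Zint: "(\<integral>\<^sup>+w. Z w \<partial>M) \<le> ennreal ?t" .
    have Zfin: "AE w in M. Z w \<noteq> \<infinity>"
      using Zint by (intro nn_integral_noteq_infinite) (auto simp: top_unique)
    have Zeq: "(\<integral>\<^sup>+w. ennreal (enn2real (Z w)) \<partial>M) = (\<integral>\<^sup>+w. Z w \<partial>M)"
      using Zfin by (intro nn_integral_cong_AE) (auto simp: less_top)
    have Zi: "integrable M (\<lambda>w. enn2real (Z w))"
      using Zint by (intro integrableI_nonneg) (auto simp: Zeq intro: le_less_trans)
    have "(\<integral>w. enn2real (Z w) \<partial>M) = enn2real (\<integral>\<^sup>+w. Z w \<partial>M)"
      by (subst integral_eq_nn_integral) (auto simp: Zeq)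
    also have "\<dots> \<le> ?t" by (rule enn2real_leI[OF t0 Zint])
    finally have Zle: "(\<integral>w. enn2real (Z w) \<partial>M) \<le> ?t" .
    define u where "u = (\<lambda>w. enn2real (Z w) - B * p w)"
    have u: "integrable M u" unfolding u_def using Zi p by auto
    have "AE w in M. biconjugate (k w) (y w) \<le> ereal (u w)"
      using conv affine Zfin AE_space
    proof eventually_elim
      case (elim w)
      show ?case
      proof (rule biconjugate_le)
        fix \<phi> d assume d: "conjugate (k w) \<phi> \<le> ereal d"
        have "blinfun_apply \<phi> (y w) - d + B * p w \<le> enn2real (Z w)"
        proof (rule field_le_epsilon)
          fix e :: real assume "0 < e"
          \<comment> \<open>A smaller slack than \<open>\<epsilon>\<close> is allowed because \<open>G\<close> is nonnegative.\<close>
          define \<epsilon>' where "\<epsilon>' = min e \<epsilon>"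
          have \<epsilon>': "0 < \<epsilon>'" "\<epsilon>' \<le> e" "\<epsilon>' \<le> \<epsilon>" using \<epsilon> \<open>0 < e\<close> by (auto simp: \<epsilon>'_def)
          define t where "t = (\<lambda>z. blinfun_apply \<phi> z - d - \<epsilon>' + B * p w)"
          obtain N' where N': "\<And>n. N' \<le> n \<Longrightarrow> blinfun_apply \<phi> (ys n w) - d - \<epsilon>' \<le> v n w + \<epsilon>' * G n w"
            using elim(2) d \<epsilon>'(1) unfolding eventually_sequentially by blast
          have tW: "t (ys n w) \<le> W n w" if "N' \<le> n" for n
            using N'[OF that] mult_right_mono[OF \<epsilon>'(3) G(2)[OF elim(4), of n]]
            unfolding t_def W_def by linarith
          have tV: "t (\<Sum>i\<in>I n. c n i *\<^sub>R ys i w) \<le> V n w" if "N' \<le> n" for n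
          proof -
            have "t (\<Sum>i\<in>I n. c n i *\<^sub>R ys i w)
                = (\<Sum>i\<in>I n. c n i * blinfun_apply \<phi> (ys i w)) + sum (c n) (I n) * (B * p w - d - \<epsilon>')"
              unfolding t_def using c(2)[of n] by (simp add: blinfun.sum_right blinfun.scaleR_right)
            also have "\<dots> = (\<Sum>i\<in>I n. c n i * t (ys i w))"
              unfolding t_def sum_distrib_right sum.distrib[symmetric]
              by (intro sum.cong) (auto simp: algebra_simps)
            also have "\<dots> \<le> V n w"
              unfolding V_def using c(1) I(2)[of n] that by (intro sum_mono mult_left_mono tW) auto
            finally show ?thesis .
          qed
          have "(\<lambda>n. t (\<Sum>i\<in>I n. c n i *\<^sub>R ys i w)) \<longlonglongrightarrow> t (y w)"
            unfolding t_def by (intro tendsto_intros blinfun.tendsto elim(1))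
          then have "(\<lambda>n. ennreal (t (\<Sum>i\<in>I n. c n i *\<^sub>R ys i w))) \<longlonglongrightarrow> ennreal (t (y w))"
            by (rule tendsto_ennrealI)
          then have "ennreal (t (y w)) = liminf (\<lambda>n. ennreal (t (\<Sum>i\<in>I n. c n i *\<^sub>R ys i w)))"
            by (intro lim_imp_Liminf[symmetric]) auto
          also have "\<dots> \<le> Z w"
            unfolding Z_def
          proof (rule Liminf_mono)
            show "\<forall>\<^sub>F n in sequentially. ennreal (t (\<Sum>i\<in>I n. c n i *\<^sub>R ys i w)) \<le> ennreal (V n w)"
              using eventually_ge_at_top[of N'] by eventually_elim (intro ennreal_leI tV)
          qed
          finally have "t (y w) \<le> enn2real (Z w)"
            using elim(3) by (rule le_enn2realI)
          then show "blinfun_apply \<phi> (y w) - d + B * p w \<le> enn2real (Z w) + e"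
            using \<epsilon>'(2) unfolding t_def by linarith
        qed
        then show "ereal (blinfun_apply \<phi> (y w) - d) \<le> ereal (u w)" unfolding u_def by simp
      qed
    qed
    then have "outer_integral M (\<lambda>w. biconjugate (k w) (y w)) \<le> ereal (\<integral>w. u w \<partial>M)"
      by (rule outer_integral_le[OF u])
    also have "\<dots> \<le> ereal (l + \<epsilon> * C)"
      unfolding u_def using Zi p Zle by simp
    finally show ?thesis .
  qed
  show ?thesis
  proof (rule ereal_le_epsilon2)
    fix e :: real assume e: "0 < e"
    have "outer_integral M (\<lambda>w. biconjugate (k w) (y w)) \<le> ereal (l + e / (\<bar>C\<bar> + 1) * C)"
      using e by (intro main) auto
    also have "e / (\<bar>C\<bar> + 1) * C \<le> e"
      using e by (simp add: field_simps abs_if)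
    finally show "outer_integral M (\<lambda>w. biconjugate (k w) (y w)) \<le> ereal l + ereal e" by simp
  qed
qed

section \<open>Measurability, negative parts and the concentration modulus\<close>

text \<open>
  The Borel sets of a product can be generated by rectangles as soon as one factor has a countable
  base: for each basic open \<open>V\<close> in that factor, the open sets \<open>U\<close> of the other one with \<open>U \<times> V \<subseteq> S\<close>
  have a largest member.
\<close>

lemma borel_measurable_Pair_second_countable:
  fixes x :: "'w \<Rightarrow> 'e::topological_space" and y :: "'w \<Rightarrow> 'f::second_countable_topology"
  assumes x: "x \<in> borel_measurable M" and y: "y \<in> borel_measurable M"
  shows "(\<lambda>w. (x w, y w)) \<in> borel_measurable M"
proof (rule borel_measurableI)
  fix S :: "('e \<times> 'f) set" assume S: "open S"
  obtain \<B> :: "'f set set" where \<B>: "countable \<B>" "topological_basis \<B>"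
    using ex_countable_basis by blast
  define U where "U = (\<lambda>V :: 'f set. \<Union>{U. open U \<and> U \<times> V \<subseteq> S})"
  have "(\<lambda>w. (x w, y w)) -` S \<inter> space M = (\<Union>V\<in>\<B>. (x -` U V \<inter> space M) \<inter> (y -` V \<inter> space M))"
  proof (intro subset_antisym subsetI)
    fix w assume w: "w \<in> (\<lambda>w. (x w, y w)) -` S \<inter> space M"
    then have "(x w, y w) \<in> S" by auto
    then obtain A B where "open A" "open B" "(x w, y w) \<in> A \<times> B" "A \<times> B \<subseteq> S"
      by (rule open_prod_elim[OF S])
    then have AB: "open A" "open B" "x w \<in> A" "y w \<in> B" "A \<times> B \<subseteq> S" by auto
    obtain V where V: "V \<in> \<B>" "y w \<in> V" "V \<subseteq> B"
      using topological_basisE[OF \<B>(2) AB(2,4)] by blast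
    then have "A \<times> V \<subseteq> S" using AB(5) by auto
    then have "x w \<in> U V" unfolding U_def using AB(1,3) by auto
    then show "w \<in> (\<Union>V\<in>\<B>. (x -` U V \<inter> space M) \<inter> (y -` V \<inter> space M))"
      using V w by auto
  qed (auto simp: U_def)
  moreover have "x -` U V \<inter> space M \<in> sets M" for V
    unfolding U_def by (intro measurable_sets[OF x] borel_open open_Union) auto
  moreover have "y -` V \<inter> space M \<in> sets M" if "V \<in> \<B>" for V
    using topological_basis_open[OF \<B>(2) that] by (intro measurable_sets[OF y] borel_open)
  ultimately show "(\<lambda>w. (x w, y w)) -` S \<inter> space M \<in> sets M"
    by (metis (no_types, lifting) sets.countable_UN''[OF \<B>(1)] sets.Int)
qed

lemma L1_norm_negative_part:
  "L1_norm M (negative_part v) = (\<integral>\<^sup>+w. e2ennreal (- v w) \<partial>M)"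
proof -
  have "e2ennreal \<bar>negative_part v w\<bar> = e2ennreal (- v w)" for w
    unfolding negative_part_def by (cases "v w") (auto simp: max_def e2ennreal_neg ennreal_neg)
  then show ?thesis unfolding L1_norm_def by simp
qed

lemma outer_integral_uminus_le:
  fixes v :: "'w \<Rightarrow> ereal"
  assumes [measurable]: "v \<in> borel_measurable M" and S [measurable]: "S \<in> sets M"
    and D: "(\<integral>\<^sup>+w. e2ennreal (- v w) * indicator S w \<partial>M) \<le> ennreal D" and D0: "0 \<le> D"
  shows "outer_integral (restrict_space M S) (\<lambda>w. - v w) \<le> ereal D"
proof -
  let ?N = "restrict_space M S"
  define u where "u = (\<lambda>w. enn2real (e2ennreal (- v w)))"
  have [measurable]: "v \<in> borel_measurable ?N" by (rule measurable_restrict_space1) simp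
  have [measurable]: "u \<in> borel_measurable ?N" unfolding u_def by measurable
  have le: "(\<integral>\<^sup>+w. e2ennreal (- v w) \<partial>?N) \<le> ennreal D"
    using D S by (subst nn_integral_restrict_space) auto
  have fin: "AE w in ?N. e2ennreal (- v w) \<noteq> \<infinity>"
    using le by (intro nn_integral_noteq_infinite) (auto simp: top_unique)
  have eq: "(\<integral>\<^sup>+w. ennreal (u w) \<partial>?N) = (\<integral>\<^sup>+w. e2ennreal (- v w) \<partial>?N)"
    unfolding u_def using fin by (intro nn_integral_cong_AE) (auto simp: less_top)
  have u: "integrable ?N u"
  proof (rule integrableI_nonneg)
    show "(\<integral>\<^sup>+w. ennreal (u w) \<partial>?N) < \<infinity>"
      unfolding eq using le by (auto intro: le_less_trans)
  qed (auto simp: u_def)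
  have "(\<integral>w. u w \<partial>?N) = enn2real (\<integral>\<^sup>+w. e2ennreal (- v w) \<partial>?N)"
    unfolding eq[symmetric] by (rule integral_eq_nn_integral) (auto simp: u_def)
  also have "\<dots> \<le> D" by (rule enn2real_leI[OF D0 le])
  finally have uD: "(\<integral>w. u w \<partial>?N) \<le> D" .
  have "AE w in ?N. - v w \<le> ereal (u w)"
    using fin
  proof eventually_elim
    case (elim w)
    show ?case
    proof (cases "v w")
      case (real r)
      then show ?thesis by (cases "0 \<le> - r") (auto simp: u_def e2ennreal_ereal ennreal_neg)
    next
      case MInf
      then show ?thesis using elim by simp
    qed simp
  qed
  from outer_integral_le[OF u this] uD show ?thesis
    by (metis ereal_less_eq(3) order_trans)
qed

text \<open>
  The constant sequence of empty sets contributes the value zero. Together with an upper bound this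
  makes \<open>\<delta>\<^sup>+\<close> finite, so that the difference \<open>\<infinity> - \<infinity>\<close> cannot arise in the lower bound.
\<close>

lemma delta_plus_nonneg: "0 \<le> delta_plus M u"
proof -
  let ?N = "restrict_space M {}"
  have "0 \<le> outer_integral ?N (u n)" for n
  proof -
    have "ereal (\<integral>w. 0 \<partial>?N) \<le> outer_integral ?N (u n)"
      by (rule integral_le_outer_integral) (auto simp: AE_restrict_space_iff)
    then show ?thesis by (simp add: zero_ereal_def)
  qed
  then have "0 \<le> (SUP n\<in>{k..}. outer_integral ?N (u n))" for k
    by (intro SUP_upper2[of k]) auto
  then have "0 \<le> limsup (\<lambda>k. SUP n\<in>{k..}. outer_integral ?N (u n))"
    by (intro le_Limsup always_eventually) auto
  also have "\<dots> \<le> delta_plus M u"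
    unfolding delta_plus_def by (rule SUP_upper2[of "\<lambda>_. {}"]) (auto simp: decseq_def)
  finally show ?thesis .
qed

lemma delta_plus_uminus_le:
  fixes v :: "nat \<Rightarrow> 'w \<Rightarrow> ereal"
  assumes v: "\<And>n. v n \<in> borel_measurable M" and D0: "0 \<le> D"
    and D: "\<And>S. (\<And>k. S k \<in> sets M) \<Longrightarrow> decseq S \<Longrightarrow> (\<Inter>k. S k) \<in> null_sets M \<Longrightarrow>
      \<exists>K. \<forall>k\<ge>K. \<forall>n\<ge>k. (\<integral>\<^sup>+w. e2ennreal (- v n w) * indicator (S k) w \<partial>M) \<le> ennreal D"
  shows "delta_plus M (\<lambda>n w. - v n w) \<le> ereal D"
  unfolding delta_plus_def
proof (rule SUP_least, clarify)
  fix S :: "nat \<Rightarrow> 'w set" assume S: "\<forall>k. S k \<in> sets M" "decseq S" "(\<Inter>k. S k) \<in> null_sets M"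
  obtain K where K: "\<And>k n. K \<le> k \<Longrightarrow> k \<le> n \<Longrightarrow>
      (\<integral>\<^sup>+w. e2ennreal (- v n w) * indicator (S k) w \<partial>M) \<le> ennreal D"
    using D[of S] S by blast
  show "limsup (\<lambda>k. SUP n\<in>{k..}. outer_integral (restrict_space M (S k)) (\<lambda>w. - v n w)) \<le> ereal D"
  proof (rule Limsup_bounded)
    show "\<forall>\<^sub>F k in sequentially. (SUP n\<in>{k..}. outer_integral (restrict_space M (S k)) (\<lambda>w. - v n w)) \<le> ereal D"
      using eventually_ge_at_top[of K]
    proof eventually_elim
      case (elim k)
      show ?case
        using S(1) K[OF elim] D0 v by (intro SUP_least outer_integral_uminus_le) auto
    qed
  qed
qed

text \<open>
  Split \<open>S k\<close> along the set \<open>K\<close> of finite measure given by equi-integrability. The measures of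
  \<open>S k \<inter> K\<close> tend to zero by continuity from above, and the part off \<open>K\<close> is uniformly small.
\<close>

lemma uniformly_integrable_delta_plus_le_zero:
  fixes v :: "nat \<Rightarrow> 'w \<Rightarrow> ereal"
  assumes v [measurable]: "\<And>n. v n \<in> borel_measurable M"
    and ui: "uniformly_integrable M ((\<lambda>n. negative_part (v n)) ` {n0..})"
  shows "delta_plus M (\<lambda>n w. - v n w) \<le> 0"
proof -
  have norm: "L1_norm M (\<lambda>w. negative_part (v n) w * indicator A w)
      = (\<integral>\<^sup>+w. e2ennreal (- v n w) * indicator A w \<partial>M)" for n A
  proof -
    have "e2ennreal \<bar>negative_part (v n) w * indicator A w\<bar> = e2ennreal (- v n w) * indicator A w" for w
      unfolding negative_part_def
      by (cases "v n w") (auto simp: max_def e2ennreal_neg ennreal_neg indicator_def)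
    then show ?thesis unfolding L1_norm_def by simp
  qed
  have "delta_plus M (\<lambda>n w. - v n w) \<le> 0 + ereal e" if e: "0 < e" for e :: real
  proof -
    have e2: "0 < e / 2" using e by simp
    obtain \<eta> K where \<eta>: "0 < \<eta>" and K [measurable]: "K \<in> sets M" and Kfin: "emeasure M K < \<infinity>"
      and small: "\<And>A n. A \<in> sets M \<Longrightarrow> emeasure M A \<le> ennreal \<eta> \<Longrightarrow> n0 \<le> n \<Longrightarrow>
          (\<integral>\<^sup>+w. e2ennreal (- v n w) * indicator A w \<partial>M) \<le> ennreal (e/2)"
      and out: "\<And>n. n0 \<le> n \<Longrightarrow> (\<integral>\<^sup>+w. e2ennreal (- v n w) * indicator (space M - K) w \<partial>M) \<le> ennreal (e/2)"
    proof -
      obtain \<eta> K where *: "0 < \<eta>" "K \<in> sets M" "emeasure M K < \<infinity>"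
        and A: "\<And>A. A \<in> sets M \<Longrightarrow> emeasure M A \<le> ennreal \<eta> \<Longrightarrow>
            (SUP u\<in>(\<lambda>n. negative_part (v n)) ` {n0..}. L1_norm M (\<lambda>w. u w * indicator A w)) < ennreal (e/2)"
        and O: "(SUP u\<in>(\<lambda>n. negative_part (v n)) ` {n0..}. L1_norm M (\<lambda>w. u w * indicator (space M - K) w)) < ennreal (e/2)"
        using ui e2 unfolding uniformly_integrable_def equi_integrable_def by meson
      have "(\<integral>\<^sup>+w. e2ennreal (- v n w) * indicator A w \<partial>M)
          \<le> (SUP u\<in>(\<lambda>n. negative_part (v n)) ` {n0..}. L1_norm M (\<lambda>w. u w * indicator A w))" if "n0 \<le> n" for A n
        using that by (intro SUP_upper2[of "negative_part (v n)"]) (auto simp: norm)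
      then show thesis
        using that[OF *] A O by (meson order_trans less_imp_le)
    qed
    have "delta_plus M (\<lambda>n w. - v n w) \<le> ereal e"
    proof (rule delta_plus_uminus_le)
      fix S :: "nat \<Rightarrow> 'w set"
      assume S [measurable]: "\<And>k. S k \<in> sets M" and dec: "decseq S" and null: "(\<Inter>k. S k) \<in> null_sets M"
      have "(\<lambda>k. emeasure M (S k \<inter> K)) \<longlonglongrightarrow> emeasure M (\<Inter>k. S k \<inter> K)"
      proof (rule Lim_emeasure_decseq)
        show "decseq (\<lambda>k. S k \<inter> K)" using dec by (auto simp: decseq_def)
        show "emeasure M (S k \<inter> K) \<noteq> \<infinity>" for k
          using emeasure_mono[of "S k \<inter> K" K M] Kfin by (auto simp: top_unique)
      qed auto
      moreover have "emeasure M (\<Inter>k. S k \<inter> K) = 0"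
      proof -
        have "emeasure M (\<Inter>k. S k \<inter> K) \<le> emeasure M (\<Inter>k. S k)"
          using null by (intro emeasure_mono) auto
        then show ?thesis using null by (simp add: null_sets_def)
      qed
      ultimately have "(\<lambda>k. emeasure M (S k \<inter> K)) \<longlonglongrightarrow> 0" by simp
      moreover have "0 < ennreal \<eta>" using \<eta> by simp
      ultimately have "\<forall>\<^sub>F k in sequentially. emeasure M (S k \<inter> K) < ennreal \<eta>"
        by (rule order_tendstoD)
      then obtain k0 where k0: "\<And>k. k0 \<le> k \<Longrightarrow> emeasure M (S k \<inter> K) < ennreal \<eta>"
        by (auto simp: eventually_sequentially)
      have "(\<integral>\<^sup>+w. e2ennreal (- v n w) * indicator (S k) w \<partial>M) \<le> ennreal e"
        if k: "max k0 n0 \<le> k" "k \<le> n" for k n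
      proof -
        have "(\<integral>\<^sup>+w. e2ennreal (- v n w) * indicator (S k) w \<partial>M)
            \<le> (\<integral>\<^sup>+w. e2ennreal (- v n w) * indicator (S k \<inter> K) w + e2ennreal (- v n w) * indicator (space M - K) w \<partial>M)"
          by (intro nn_integral_mono) (auto simp: indicator_def)
        also have "\<dots> = (\<integral>\<^sup>+w. e2ennreal (- v n w) * indicator (S k \<inter> K) w \<partial>M)
            + (\<integral>\<^sup>+w. e2ennreal (- v n w) * indicator (space M - K) w \<partial>M)"
          by (intro nn_integral_add) measurable
        also have "\<dots> \<le> ennreal (e/2) + ennreal (e/2)"
          using k k0[of k] by (intro add_mono small out) auto
        also have "\<dots> = ennreal e" using e by (simp add: ennreal_plus[symmetric] del: ennreal_plus)
        finally show ?thesis .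
      qed
      then show "\<exists>K. \<forall>k\<ge>K. \<forall>n\<ge>k. (\<integral>\<^sup>+w. e2ennreal (- v n w) * indicator (S k) w \<partial>M) \<le> ennreal e"
        by (intro exI[of _ "max k0 n0"]) auto
    qed (use e v in auto)
    then show ?thesis by simp
  qed
  then show ?thesis by (rule ereal_le_epsilon2)
qed

text \<open>
  An upper integral below \<open>+\<infinity>\<close> comes from an integrable majorant; with an integrable negative part the
  function is then integrable, and its integral is at most that of the majorant.
\<close>

lemma real_representative:
  fixes v :: "'w \<Rightarrow> ereal"
  assumes [measurable]: "v \<in> borel_measurable M"
    and neg: "(\<integral>\<^sup>+w. e2ennreal (- v w) \<partial>M) \<le> ennreal C" and l: "outer_integral M v < ereal l"
  defines "z \<equiv> \<lambda>w. real_of_ereal (v w)"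
  shows "AE w in M. v w = ereal (z w)" and "integrable M z" and "(\<integral>w. z w \<partial>M) < l"
    and "(\<integral>\<^sup>+w. ennreal (- z w) \<partial>M) \<le> ennreal C"
proof -
  obtain u where u: "integrable M u" "AE w in M. v w \<le> ereal (u w)" "(\<integral>w. u w \<partial>M) < l"
    using l unfolding outer_integral_def INF_less_iff by auto
  have [measurable]: "z \<in> borel_measurable M" unfolding z_def by measurable
  have "AE w in M. e2ennreal (- v w) \<noteq> \<infinity>"
    using neg by (intro nn_integral_noteq_infinite) (auto simp: top_unique)
  with u(2) show eq: "AE w in M. v w = ereal (z w)"
  proof eventually_elim
    case (elim w)
    then show ?case by (cases "v w") (auto simp: z_def)
  qed
  have "AE w in M. ennreal (- z w) = e2ennreal (- v w)"
    using eq by eventually_elim (simp add: e2ennreal_ereal)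
  then have "(\<integral>\<^sup>+w. ennreal (- z w) \<partial>M) = (\<integral>\<^sup>+w. e2ennreal (- v w) \<partial>M)"
    by (rule nn_integral_cong_AE)
  then show nz: "(\<integral>\<^sup>+w. ennreal (- z w) \<partial>M) \<le> ennreal C" using neg by simp
  have zu: "AE w in M. z w \<le> u w"
    using u(2) eq by eventually_elim simp
  have m: "integrable M (\<lambda>w. max (- z w) 0)"
  proof (rule integrableI_nonneg)
    have "(\<integral>\<^sup>+w. ennreal (max (- z w) 0) \<partial>M) = (\<integral>\<^sup>+w. ennreal (- z w) \<partial>M)"
      by (intro nn_integral_cong) (auto simp: max_def ennreal_neg)
    then show "(\<integral>\<^sup>+w. ennreal (max (- z w) 0) \<partial>M) < \<infinity>" using nz by (auto intro: le_less_trans)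
  qed auto
  show z: "integrable M z"
  proof (rule Bochner_Integration.integrable_bound)
    show "integrable M (\<lambda>w. \<bar>u w\<bar> + max (- z w) 0)" using u(1) m by auto
    show "AE w in M. norm (z w) \<le> norm (\<bar>u w\<bar> + max (- z w) 0)"
      using zu by eventually_elim auto
  qed simp
  show "(\<integral>w. z w \<partial>M) < l" using integral_mono_AE[OF z u(1) zu] u(3) by simp
qed

section \<open>Lower semicontinuity of the integral functional\<close>

lemma frequently_less_liminf:
  fixes X :: "nat \<Rightarrow> ereal"
  assumes "liminf X < l"
  shows "\<exists>\<^sub>F n in sequentially. n0 \<le> n \<and> X n < l"
proof -
  have "\<exists>\<^sub>F n in sequentially. X n < l"
  proof (rule ccontr)
    assume "\<not> ?thesis"
    then have "l \<le> liminf X" by (intro Liminf_bounded) (simp add: not_frequently not_less)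
    then show False using assms by simp
  qed
  then show ?thesis
    using eventually_ge_at_top[of n0] by (simp add: frequently_eventually_conj)
qed

lemma outer_integral_cong_AE:
  assumes "AE w in M. u w = v w"
  shows "outer_integral M u = outer_integral M v"
proof -
  have "(AE w in M. u w \<le> ereal (z w)) = (AE w in M. v w \<le> ereal (z w))" for z
  proof (rule eventually_subst)
    show "AE w in M. (u w \<le> ereal (z w)) = (v w \<le> ereal (z w))"
      using assms by eventually_elim simp
  qed
  then show ?thesis unfolding outer_integral_def by simp
qed

lemma integrand_composition_measurable:
  fixes f :: "'w \<Rightarrow> 'e::topological_space \<Rightarrow> 'f::second_countable_topology \<Rightarrow> ereal"
  assumes f: "(\<lambda>(w, e, e'). f w e e') \<in> borel_measurable (M \<Otimes>\<^sub>M (borel :: ('e \<times> 'f) measure))"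
    and x: "x \<in> borel_measurable M" and y: "y \<in> borel_measurable M"
  shows "(\<lambda>w. f w (x w) (y w)) \<in> borel_measurable M"
proof -
  have "(\<lambda>w. (w, (x w, y w))) \<in> M \<rightarrow>\<^sub>M M \<Otimes>\<^sub>M borel"
    by (intro measurable_Pair measurable_ident_sets[OF refl] borel_measurable_Pair_second_countable x y)
  from measurable_compose[OF this f] show ?thesis by simp
qed

text \<open>
  The convergence hypotheses speak of subsequences because the argument passes to one before it uses
  them. It suffices to bound the upper integral of \<open>g\<^sup>*\<^sup>*(x, y)\<close> by \<open>l + (\<delta>\<^sup>+ + \<epsilon>)\<close> for each real
  \<open>l\<close> above the lower limit, and for this one works along a subsequence on which the integrals are below \<open>l\<close>.
\<close>

theorem liminf_integral_functional_ge:
  fixes M :: "'w measure" and f :: "'w \<Rightarrow> 'e::topological_space \<Rightarrow> 'f::{banach, second_countable_topology} \<Rightarrow> ereal"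
    and x :: "'w \<Rightarrow> 'e" and y :: "'w \<Rightarrow> 'f" and xs :: "nat \<Rightarrow> 'w \<Rightarrow> 'e" and ys :: "nat \<Rightarrow> 'w \<Rightarrow> 'f"
  assumes sf: "sigma_finite_measure M"
    and f_meas: "(\<lambda>(w, e, e'). f w e e') \<in> borel_measurable (M \<Otimes>\<^sub>M (borel :: ('e \<times> 'f) measure))"
    and y [measurable]: "y \<in> borel_measurable M"
    and xs [measurable]: "\<And>n. xs n \<in> borel_measurable M" and ys [measurable]: "\<And>n. ys n \<in> borel_measurable M"
    and xs_conv: "\<And>r :: nat \<Rightarrow> nat. strict_mono r \<Longrightarrow> \<exists>s. strict_mono s \<and> (AE w in M. (\<lambda>n. xs (r (s n)) w) \<longlonglongrightarrow> x w)"
    and ys_conv: "\<And>r :: nat \<Rightarrow> nat. strict_mono r \<Longrightarrow> biting_converges M (\<lambda>n. ys (r n)) y"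
    and tight: "nagumo_tight M ys"
    and bdd: "L1_bounded M ((\<lambda>n. negative_part (\<lambda>w. f w (xs n w) (ys n w))) ` {n0..})"
  shows "integral_functional M (partial_biconjugate (seq_regularization f)) x y
             - delta_plus M (\<lambda>n w. - f w (xs n w) (ys n w))
         \<le> liminf (\<lambda>n. integral_functional M f (xs n) (ys n))"
proof -
  define F where "F = (\<lambda>n w. f w (xs n w) (ys n w))"
  let ?I = "\<lambda>n. outer_integral M (F n)"
  let ?g = "\<lambda>w. partial_biconjugate (seq_regularization f) w (x w) (y w)"
  let ?\<delta> = "delta_plus M (\<lambda>n w. - F n w)"
  have F [measurable]: "F n \<in> borel_measurable M" for n
    unfolding F_def by (rule integrand_composition_measurable[OF f_meas xs ys])
  obtain Cn where Cn: "\<And>n. n0 \<le> n \<Longrightarrow> (\<integral>\<^sup>+w. e2ennreal (- F n w) \<partial>M) \<le> ennreal Cn" and Cn0: "0 \<le> Cn"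
  proof -
    let ?s = "SUP u\<in>(\<lambda>n. negative_part (F n)) ` {n0..}. L1_norm M u"
    have fin: "?s < \<infinity>" using bdd unfolding L1_bounded_def F_def by simp
    have "(\<integral>\<^sup>+w. e2ennreal (- F n w) \<partial>M) \<le> ennreal (enn2real ?s)" if "n0 \<le> n" for n
    proof -
      have "(\<integral>\<^sup>+w. e2ennreal (- F n w) \<partial>M) \<le> ?s"
        using that by (intro SUP_upper2[of "negative_part (F n)"]) (auto simp: L1_norm_negative_part)
      then show ?thesis using fin by (simp add: less_top)
    qed
    then show thesis using that enn2real_nonneg by blast
  qed
  have "?\<delta> \<le> ereal Cn"
  proof (rule delta_plus_uminus_le[OF F Cn0])
    fix S :: "nat \<Rightarrow> 'w set"
    have "(\<integral>\<^sup>+w. e2ennreal (- F n w) * indicator (S k) w \<partial>M) \<le> (\<integral>\<^sup>+w. e2ennreal (- F n w) \<partial>M)" for n k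
      by (intro nn_integral_mono) (auto simp: indicator_def)
    then show "\<exists>K. \<forall>k\<ge>K. \<forall>n\<ge>k. (\<integral>\<^sup>+w. e2ennreal (- F n w) * indicator (S k) w \<partial>M) \<le> ennreal Cn"
      using Cn by (intro exI[of _ n0]) (meson order_trans)
  qed
  moreover have "0 \<le> ?\<delta>" by (rule delta_plus_nonneg)
  ultimately obtain D where D: "?\<delta> = ereal D" by (cases ?\<delta>) auto
  obtain h where h: "nagumo_integrand M h" and hfin: "(SUP n. \<integral>\<^sup>+w. e2ennreal (h w (ys n w)) \<partial>M) < \<infinity>"
    using tight unfolding nagumo_tight_def by blast
  have h0: "\<And>w e. w \<in> space M \<Longrightarrow> 0 \<le> h w e"
    and hcomp: "\<And>w (\<phi> :: 'f \<Rightarrow>\<^sub>L real) r::real. w \<in> space M \<Longrightarrow>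
        compactin weak_topology {e. h w e - ereal (blinfun_apply \<phi> e) \<le> ereal r}"
    using h unfolding nagumo_integrand_def by auto
  have hm [measurable]: "(\<lambda>w. h w (ys n w)) \<in> borel_measurable M" for n
  proof -
    have "(\<lambda>w. (w, ys n w)) \<in> M \<rightarrow>\<^sub>M M \<Otimes>\<^sub>M borel"
      by (intro measurable_Pair measurable_ident_sets[OF refl] ys)
    moreover have "(\<lambda>(w, e). h w e) \<in> borel_measurable (M \<Otimes>\<^sub>M borel)"
      using h unfolding nagumo_integrand_def by simp
    ultimately show ?thesis using measurable_compose by fastforce
  qed
  define H where "H = (\<lambda>n w. real_of_ereal (h w (ys n w)))"
  define CH where "CH = enn2real (SUP n. \<integral>\<^sup>+w. e2ennreal (h w (ys n w)) \<partial>M)"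
  have H0: "0 \<le> H n w" if "w \<in> space M" for n w
    unfolding H_def using h0[OF that] by (simp add: real_of_ereal_pos)
  have H: "AE w in M. h w (ys n w) = ereal (H n w)" "integrable M (H n)" "(\<integral>w. H n w \<partial>M) \<le> CH" for n
  proof -
    have le: "(\<integral>\<^sup>+w. e2ennreal (h w (ys n w)) \<partial>M) \<le> ennreal CH"
    proof -
      have "(\<integral>\<^sup>+w. e2ennreal (h w (ys n w)) \<partial>M) \<le> (SUP n. \<integral>\<^sup>+w. e2ennreal (h w (ys n w)) \<partial>M)"
        by (rule SUP_upper) simp
      then show ?thesis unfolding CH_def using hfin by (simp add: less_top)
    qed
    have "AE w in M. e2ennreal (h w (ys n w)) \<noteq> \<infinity>"
      using le by (intro nn_integral_noteq_infinite) (auto simp: top_unique)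
    then show eq: "AE w in M. h w (ys n w) = ereal (H n w)"
      using AE_space
    proof eventually_elim
      case (elim w)
      then show ?case using h0[OF elim(2), of "ys n w"] by (cases "h w (ys n w)") (auto simp: H_def)
    qed
    have [measurable]: "H n \<in> borel_measurable M" unfolding H_def by measurable
    have "(\<integral>\<^sup>+w. ennreal (H n w) \<partial>M) = (\<integral>\<^sup>+w. e2ennreal (h w (ys n w)) \<partial>M)"
      using eq by (intro nn_integral_cong_AE) auto
    then have le': "(\<integral>\<^sup>+w. ennreal (H n w) \<partial>M) \<le> ennreal CH" using le by simp
    show "integrable M (H n)"
    proof (rule integrableI_nonneg)
      show "(\<integral>\<^sup>+w. ennreal (H n w) \<partial>M) < \<infinity>" using le' by (auto intro: le_less_trans)
    qed (use H0 in auto)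
    have "(\<integral>w. H n w \<partial>M) = enn2real (\<integral>\<^sup>+w. ennreal (H n w) \<partial>M)"
      using H0 by (intro integral_eq_nn_integral) auto
    also have "\<dots> \<le> CH" using le' by (intro enn2real_leI) (auto simp: CH_def)
    finally show "(\<integral>w. H n w \<partial>M) \<le> CH" .
  qed
  obtain p where p: "integrable M p" "\<And>w. w \<in> space M \<Longrightarrow> 0 < (p w :: real)"
  proof -
    obtain q where q [measurable]: "q \<in> borel_measurable M" and qi: "integral\<^sup>N M q \<noteq> \<infinity>"
      and q0: "\<forall>w\<in>space M. 0 < q w \<and> q w < \<infinity>"
      using sigma_finite_measure.Ex_finite_integrable_function[OF sf] by blast
    have "(\<integral>\<^sup>+w. ennreal (enn2real (q w)) \<partial>M) = integral\<^sup>N M q"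
      using q0 by (intro nn_integral_cong) auto
    then have "integrable M (\<lambda>w. enn2real (q w))"
      using qi by (intro integrableI_nonneg) (auto simp: less_top)
    moreover have "0 < enn2real (q w)" if "w \<in> space M" for w
      using q0 that by (auto simp: enn2real_positive_iff)
    ultimately show thesis using that by blast
  qed
  have main: "outer_integral M ?g \<le> ereal (l + (D + \<epsilon>))" if l: "liminf ?I < ereal l" and \<epsilon>: "0 < \<epsilon>" for l \<epsilon>
  proof -
    obtain r0 where r0: "strict_mono (r0 :: nat \<Rightarrow> nat)" "\<And>n. n0 \<le> r0 n \<and> ?I (r0 n) < ereal l"
      using frequently_subsequence[of "\<lambda>k n. n0 \<le> n \<and> ?I n < ereal l"] frequently_less_liminf[OF l] by blast
    obtain r1 where r1: "strict_mono (r1 :: nat \<Rightarrow> nat)" "AE w in M. (\<lambda>n. xs (r0 (r1 n)) w) \<longlonglongrightarrow> x w"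
      using xs_conv[OF r0(1)] by blast
    define q where "q = (\<lambda>n. r0 (r1 n))"
    have q: "strict_mono q" "\<And>n. n0 \<le> q n" "\<And>n. ?I (q n) < ereal l"
      using strict_mono_o[OF r0(1) r1(1)] r0(2) by (auto simp: q_def comp_def)
    define v where "v = (\<lambda>n w. real_of_ereal (F (q n) w))"
    have v: "AE w in M. F (q n) w = ereal (v n w)" "integrable M (v n)" "(\<integral>w. v n w \<partial>M) < l"
      "(\<integral>\<^sup>+w. ennreal (- v n w) \<partial>M) \<le> ennreal Cn" for n
      using real_representative[OF F Cn[OF q(2)] q(3)] unfolding v_def by auto
    define a where "a = (\<lambda>n w. max (- v n w) 0)"
    have a: "integrable M (a n)" "(\<integral>w. a n w \<partial>M) \<le> Cn" for n
    proof -
      show ai: "integrable M (a n)" unfolding a_def using v(2) by auto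
      have "ennreal (\<integral>w. a n w \<partial>M) = (\<integral>\<^sup>+w. ennreal (a n w) \<partial>M)"
        using ai by (intro nn_integral_eq_integral[symmetric]) (auto simp: a_def)
      also have "\<dots> = (\<integral>\<^sup>+w. ennreal (- v n w) \<partial>M)"
        by (intro nn_integral_cong) (auto simp: a_def max_def ennreal_neg)
      also have "\<dots> \<le> ennreal Cn" by (rule v(4))
      finally show "(\<integral>w. a n w \<partial>M) \<le> Cn" using Cn0 by (simp only: ennreal_le_iff)
    qed
    obtain r2 S and G :: "nat \<Rightarrow> 'w \<Rightarrow> real" where r2: "strict_mono (r2 :: nat \<Rightarrow> nat)"
      and S: "\<And>k. S k \<in> sets M" "decseq S" "(\<Inter>k. S k) \<in> null_sets M"
      and G: "\<And>k. integrable M (G k)" "\<And>k w. w \<in> space M \<Longrightarrow> 0 \<le> G k w" "\<And>k. (\<integral>w. G k w \<partial>M) \<le> 4"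
      and bite: "\<And>\<epsilon>. 0 < \<epsilon> \<Longrightarrow> \<exists>B\<ge>0. \<forall>k. \<forall>w\<in>space M - S k. a (r2 k) w \<le> \<epsilon> * G k w + B * p w"
      by (rule biting_lemma[of M a Cn p, OF a(1) _ a(2) p]) (auto simp: a_def)
    note [measurable] = S(1)
    define \<rho> where "\<rho> = (\<lambda>k. q (r2 k))"
    have \<rho>: "strict_mono \<rho>" using strict_mono_o[OF q(1) r2] by (simp add: \<rho>_def comp_def)
    have \<rho>_ge: "k \<le> \<rho> k" for k by (rule strict_mono_imp_increasing[OF \<rho>])
    \<comment> \<open>The functions without their concentrating parts; almost every point leaves all \<open>S k\<close> eventually, where nothing is changed.\<close>
    define v' where "v' = (\<lambda>k w. v (r2 k) w * indicator (space M - S k) w)"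
    have v': "integrable M (v' k)" for k
      unfolding v'_def by (intro integrable_real_mult_indicator v(2)) auto
    define G' where "G' = (\<lambda>k w. G k w + H (\<rho> k) w)"
    have G': "integrable M (G' k)" "(\<integral>w. G' k w \<partial>M) \<le> 4 + CH" for k
      unfolding G'_def using G(1,3) H(2,3) by (auto intro: add_mono)
    have G'0: "0 \<le> G' k w" "H (\<rho> k) w \<le> G' k w" "G k w \<le> G' k w" if "w \<in> space M" for k w
      using G(2)[OF that] H0[OF that] unfolding G'_def by auto
    have lower: "\<exists>B\<ge>0. \<forall>w\<in>space M. \<forall>k. - (\<delta> * G' k w + B * p w) \<le> v' k w" if \<delta>: "0 < \<delta>" for \<delta>
    proof -
      obtain B where B: "0 \<le> B" "\<And>k w. w \<in> space M \<Longrightarrow> w \<notin> S k \<Longrightarrow> a (r2 k) w \<le> \<delta> * G k w + B * p w"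
        using bite[OF \<delta>] by blast
      have "- (\<delta> * G' k w + B * p w) \<le> v' k w" if w: "w \<in> space M" for k w
      proof (cases "w \<in> S k")
        case True
        have "0 \<le> \<delta> * G' k w" "0 \<le> B * p w" using \<delta> G'0(1)[OF w] B(1) p(2)[OF w] by auto
        then show ?thesis using True unfolding v'_def by simp
      next
        case False
        have "\<delta> * G k w \<le> \<delta> * G' k w" using \<delta> G'0(3)[OF w] by simp
        moreover have "- v (r2 k) w \<le> a (r2 k) w" unfolding a_def by simp
        moreover have "v' k w = v (r2 k) w" unfolding v'_def using False w by simp
        ultimately show ?thesis using B(2)[OF w False] by linarith
      qed
      then show ?thesis using B(1) by blast
    qed
    have affine: "AE w in M. \<forall>\<phi> d \<epsilon>. conjugate (seq_regularization f w (x w)) \<phi> \<le> ereal d \<longrightarrow> 0 < \<epsilon> \<longrightarrow>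
        (\<forall>\<^sub>F k in sequentially. blinfun_apply \<phi> (ys (\<rho> k) w) - d - \<epsilon> \<le> v' k w + \<epsilon> * G' k w)"
    proof -
      have Fv: "AE w in M. \<forall>n. F (q n) w = ereal (v n w)" using v(1) by (simp add: AE_all_countable)
      have HH: "AE w in M. \<forall>n. h w (ys n w) = ereal (H n w)" using H(1) by (simp add: AE_all_countable)
      have "AE w in M. w \<notin> (\<Inter>k. S k)" using S(3) by (rule AE_not_in)
      with Fv HH r1(2) AE_space show ?thesis
      proof eventually_elim
        case (elim w)
        show ?case
        proof (intro allI impI)
          fix \<phi> d \<epsilon> assume d: "conjugate (seq_regularization f w (x w)) \<phi> \<le> ereal d" and \<epsilon>: "0 < (\<epsilon>::real)"
          have xl: "(\<lambda>k. xs (\<rho> k) w) \<longlonglongrightarrow> x w"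
            using LIMSEQ_subseq_LIMSEQ[OF elim(3) r2] by (simp add: comp_def \<rho>_def q_def)
          obtain k0 where k0: "w \<notin> S k0" using elim(5) by auto
          have "\<forall>\<^sub>F k in sequentially. f w (xs (\<rho> k) w) (ys (\<rho> k) w) = ereal (v' k w)"
            using eventually_ge_at_top[of k0]
          proof eventually_elim
            case (elim k)
            then have "w \<notin> S k" using k0 decseqD[OF S(2) elim] by auto
            then have "v' k w = v (r2 k) w" using \<open>w \<in> space M\<close> unfolding v'_def by simp
            moreover have "F (q (r2 k)) w = ereal (v (r2 k) w)" using \<open>\<forall>n. F (q n) w = ereal (v n w)\<close> by blast
            ultimately show ?case unfolding F_def \<rho>_def by simp
          qed
          moreover have "h w (ys (\<rho> k) w) \<le> ereal (G' k w)" for k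
            using elim(2) G'0(2)[OF elim(4)] by simp
          moreover have "\<exists>B. \<forall>\<^sub>F k in sequentially. - (\<delta> * G' k w + B) \<le> v' k w" if "0 < \<delta>" for \<delta>
            using lower[OF that] elim(4) by (meson always_eventually)
          ultimately show "\<forall>\<^sub>F k in sequentially. blinfun_apply \<phi> (ys (\<rho> k) w) - d - \<epsilon> \<le> v' k w + \<epsilon> * G' k w"
            by (intro eventually_affine_minorant[where h = "h w" and f = f and w = w and e = "x w"
                and a = "\<lambda>k. xs (\<rho> k) w"]) (use hcomp h0 elim(4) xl d \<epsilon> in auto)
        qed
      qed
    qed
    \<comment> \<open>Since \<open>\<rho> k \<ge> k\<close>, the supremum over \<open>n \<ge> k\<close> in the definition of \<open>\<delta>\<^sup>+\<close> bounds the loss on \<open>S k\<close>.\<close>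
    have lim: "\<forall>\<^sub>F k in sequentially. (\<integral>w. v' k w \<partial>M) \<le> l + (D + \<epsilon>)"
    proof -
      have "limsup (\<lambda>k. SUP n\<in>{k..}. outer_integral (restrict_space M (S k)) (\<lambda>w. - F n w)) \<le> ?\<delta>"
        unfolding delta_plus_def using S by (intro SUP_upper) auto
      also have "\<dots> < ereal (D + \<epsilon>)" using D \<epsilon> by simp
      finally have "\<forall>\<^sub>F k in sequentially. (SUP n\<in>{k..}. outer_integral (restrict_space M (S k)) (\<lambda>w. - F n w)) < ereal (D + \<epsilon>)"
        by (rule Limsup_lessD)
      then show ?thesis
      proof eventually_elim
        case (elim k)
        let ?N = "restrict_space M (S k)"
        have vN: "integrable ?N (\<lambda>w. - v (r2 k) w)"
          using integrable_real_mult_indicator[OF S(1) v(2)[of "r2 k"], of k] S(1)[of k]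
          by (subst integrable_restrict_space) (auto simp: mult.commute)
        have "AE w in ?N. ereal (- v (r2 k) w) \<le> - F (\<rho> k) w"
          using v(1)[of "r2 k"] S(1)[of k]
          by (subst AE_restrict_space_iff) (auto simp: \<rho>_def elim!: eventually_mono)
        then have "ereal (\<integral>w. - v (r2 k) w \<partial>?N) \<le> outer_integral ?N (\<lambda>w. - F (\<rho> k) w)"
          by (rule integral_le_outer_integral[OF vN])
        also have "\<dots> \<le> (SUP n\<in>{k..}. outer_integral ?N (\<lambda>w. - F n w))"
          using \<rho>_ge[of k] by (intro SUP_upper) auto
        also have "\<dots> < ereal (D + \<epsilon>)" by (rule elim)
        finally have 1: "(\<integral>w. - v (r2 k) w \<partial>?N) < D + \<epsilon>" by simp
        have "(\<integral>w. - v (r2 k) w \<partial>?N) = (\<integral>w. indicator (S k) w * - v (r2 k) w \<partial>M)"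
          using S(1)[of k] by (subst integral_restrict_space) auto
        also have "\<dots> = (\<integral>w. v' k w - v (r2 k) w \<partial>M)"
          by (intro Bochner_Integration.integral_cong) (auto simp: v'_def indicator_def)
        also have "\<dots> = (\<integral>w. v' k w \<partial>M) - (\<integral>w. v (r2 k) w \<partial>M)"
          using v' v(2) by (intro Bochner_Integration.integral_diff)
        finally show ?case using 1 v(3)[of "r2 k"] by simp
      qed
    qed
    obtain I and c :: "nat \<Rightarrow> nat \<Rightarrow> real" where I: "\<And>n. finite (I n)" "\<And>n. I n \<subseteq> {n..}"
      and c: "\<And>n i. i \<in> I n \<Longrightarrow> 0 \<le> c n i" "\<And>n. sum (c n) (I n) = 1"
      and conv: "AE w in M. (\<lambda>n. \<Sum>i\<in>I n. c n i *\<^sub>R ys (\<rho> i) w) \<longlonglongrightarrow> y w"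
    proof (rule biting_convex_combinations[OF ys_conv[OF \<rho>] ys y])
      fix I and c :: "nat \<Rightarrow> nat \<Rightarrow> real"
      assume Ic: "\<And>n. finite (I n)" "\<And>n. I n \<subseteq> {n..}" "\<And>n i. i \<in> I n \<Longrightarrow> 0 \<le> c n i" "\<And>n. sum (c n) (I n) = 1"
        "AE w in M. (\<lambda>n. \<Sum>i\<in>I n. c n i *\<^sub>R ys (\<rho> i) w) \<longlonglongrightarrow> y w"
      show thesis by (rule that[OF Ic])
    qed
    have "outer_integral M (\<lambda>w. biconjugate (seq_regularization f w (x w)) (y w)) \<le> ereal (l + (D + \<epsilon>))"
    proof (rule lower_closure[OF v' G'(1) G'0(1) G'(2) p(1) I c conv _ affine lim])
      fix \<delta> :: real assume "0 < \<delta>"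
      then obtain B where "\<forall>w\<in>space M. \<forall>k. - (\<delta> * G' k w + B * p w) \<le> v' k w"
        using lower by blast
      then show "\<exists>B. AE w in M. \<forall>k. - (\<delta> * G' k w + B * p w) \<le> v' k w"
        by (intro exI[of _ B] AE_I2) blast
    qed
    then show ?thesis unfolding partial_biconjugate_def .
  qed
  have "outer_integral M ?g - ?\<delta> \<le> liminf ?I"
  proof (rule dense_ge)
    fix z assume z: "liminf ?I < z"
    show "outer_integral M ?g - ?\<delta> \<le> z"
    proof (cases z)
      case (real l)
      have "outer_integral M ?g \<le> ereal (l + D) + ereal \<epsilon>" if "0 < \<epsilon>" for \<epsilon>
        using main[of l \<epsilon>] z real that by (simp add: add.assoc)
      then have "outer_integral M ?g \<le> ereal (l + D)" by (rule ereal_le_epsilon2)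
      then show ?thesis using real D by (cases "outer_integral M ?g") auto
    qed (use z in auto)
  qed
  then show ?thesis unfolding integral_functional_def F_def .
qed

text \<open>
  The topologies enter only through subsequences: convergence in the product gives convergence of both
  coordinates along every subsequence, hence almost everywhere convergence of a refinement of the first
  and Biting convergence of the second.
\<close>

theorem theorem7p1:
  fixes M :: "'w measure"
    and S :: "('w \<Rightarrow> 'e::topological_space) set topology"
    and T :: "('w \<Rightarrow> 'f::{banach, second_countable_topology}) set topology"
    and f :: "'w \<Rightarrow> 'e \<Rightarrow> 'f \<Rightarrow> ereal"
    and x :: "'w \<Rightarrow> 'e" and y :: "'w \<Rightarrow> 'f"
    and xs :: "nat \<Rightarrow> 'w \<Rightarrow> 'e" and ys :: "nat \<Rightarrow> 'w \<Rightarrow> 'f"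
  assumes "sigma_finite_measure M" and "complete_measure M"
    and "topspace S \<subseteq> L0 M" and "topspace T \<subseteq> L0 M"
    and S_conv: "\<And>u us. u \<in> borel_measurable M \<Longrightarrow> (\<And>n. us n \<in> borel_measurable M) \<Longrightarrow>
          (\<And>n. ae_class M (us n) \<in> topspace S) \<Longrightarrow>
          limitin S (\<lambda>n. ae_class M (us n)) (ae_class M u) sequentially \<Longrightarrow>
          \<exists>r. strict_mono r \<and> (AE w in M. (\<lambda>n. us (r n) w) \<longlonglongrightarrow> u w)"
    and T_conv: "\<And>v vs. v \<in> borel_measurable M \<Longrightarrow> (\<And>n. vs n \<in> borel_measurable M) \<Longrightarrow>
          (\<And>n. ae_class M (vs n) \<in> topspace T) \<Longrightarrow>
          limitin T (\<lambda>n. ae_class M (vs n)) (ae_class M v) sequentially \<Longrightarrow>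
          biting_converges M vs v"
    and f_meas: "(\<lambda>(w, e, e'). f w e e') \<in> borel_measurable (M \<Otimes>\<^sub>M (borel :: ('e \<times> 'f) measure))"
    and "x \<in> borel_measurable M" and "ae_class M x \<in> topspace S"
    and "y \<in> borel_measurable M" and "ae_class M y \<in> topspace T"
    and "\<And>n. xs n \<in> borel_measurable M" and "\<And>n. ae_class M (xs n) \<in> topspace S"
    and "\<And>n. ys n \<in> borel_measurable M" and "\<And>n. ae_class M (ys n) \<in> topspace T"
    and conv: "limitin (prod_topology S T)
          (\<lambda>n. (ae_class M (xs n), ae_class M (ys n))) (ae_class M x, ae_class M y) sequentially"
    and a: "nagumo_tight M ys"
    and b: "\<exists>n0. L1_bounded M
          ((\<lambda>n. negative_part (\<lambda>w. f w (xs n w) (ys n w))) ` {n0..})"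
  shows "liminf (\<lambda>n. integral_functional M f (xs n) (ys n))
           \<ge> integral_functional M (partial_biconjugate (seq_regularization f)) x y
             - delta_plus M (\<lambda>n w. - f w (xs n w) (ys n w))
       \<and> (lower_compactness M f xs ys \<longrightarrow>
          (AE w in M. partial_biconjugate (seq_regularization f) w (x w) (y w) = f w (x w) (y w)) \<longrightarrow>
          liminf (\<lambda>n. integral_functional M f (xs n) (ys n)) \<ge> integral_functional M f x y)"
proof (intro conjI impI)
  have xs: "\<And>n. xs n \<in> borel_measurable M" and ys: "\<And>n. ys n \<in> borel_measurable M" by fact+
  have x: "x \<in> borel_measurable M" and y: "y \<in> borel_measurable M" by fact+
  have lim: "limitin S (\<lambda>n. ae_class M (xs n)) (ae_class M x) sequentially"
    "limitin T (\<lambda>n. ae_class M (ys n)) (ae_class M y) sequentially"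
    using conv unfolding limitin_pairwise by (simp_all add: comp_def)
  have xs_conv: "\<exists>s. strict_mono s \<and> (AE w in M. (\<lambda>n. xs (r (s n)) w) \<longlonglongrightarrow> x w)"
    if "strict_mono r" for r :: "nat \<Rightarrow> nat"
  proof (rule S_conv)
    show "limitin S (\<lambda>n. ae_class M (xs (r n))) (ae_class M x) sequentially"
      using limitin_subsequence[OF that lim(1)] by (simp add: comp_def)
  qed (fact x xs assms)+
  have ys_conv: "biting_converges M (\<lambda>n. ys (r n)) y" if "strict_mono r" for r :: "nat \<Rightarrow> nat"
  proof (rule T_conv)
    show "limitin T (\<lambda>n. ae_class M (ys (r n))) (ae_class M y) sequentially"
      using limitin_subsequence[OF that lim(2)] by (simp add: comp_def)
  qed (fact y ys assms)+
  obtain n0 where n0: "L1_bounded M ((\<lambda>n. negative_part (\<lambda>w. f w (xs n w) (ys n w))) ` {n0..})"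
    using b by blast
  show lower: "integral_functional M (partial_biconjugate (seq_regularization f)) x y
             - delta_plus M (\<lambda>n w. - f w (xs n w) (ys n w))
         \<le> liminf (\<lambda>n. integral_functional M f (xs n) (ys n))"
    by (rule liminf_integral_functional_ge[OF assms(1) f_meas y xs ys xs_conv ys_conv a n0])
  assume lc: "lower_compactness M f xs ys"
    and eq: "AE w in M. partial_biconjugate (seq_regularization f) w (x w) (y w) = f w (x w) (y w)"
  have "delta_plus M (\<lambda>n w. - f w (xs n w) (ys n w)) \<le> 0"
    using lc unfolding lower_compactness_def
    by (auto intro: uniformly_integrable_delta_plus_le_zero integrand_composition_measurable[OF f_meas xs ys])
  then have "delta_plus M (\<lambda>n w. - f w (xs n w) (ys n w)) = 0"
    using delta_plus_nonneg by (rule antisym)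
  moreover have "integral_functional M (partial_biconjugate (seq_regularization f)) x y = integral_functional M f x y"
    unfolding integral_functional_def using eq by (rule outer_integral_cong_AE)
  ultimately show "integral_functional M f x y \<le> liminf (\<lambda>n. integral_functional M f (xs n) (ys n))"
    using lower by simp
qed

end
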